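(* Let $u:\mathbb{R}^m\to\mathbb{R}^m$, $u(y_1)=K_{11}y_1+g_1(y_1)$, and $v:\mathbb{R}^{m+n}\to\mathbb{R}^{n}$, $v(y_1,y_2)=K_{22}y_2+g_2(y_1,y_2)$, where $y_1\in\mathbb{R}^m$, $y_2\in\mathbb{R}^n$. Consider a one-stage SSEI method, or a two-stage SSEI method with $c_1=c_2$ (or a composition of such methods), which is volume preserving for the vector field $u$ (applied with linear part $K_{11}$ and nonlinearity $g_1$). Assume that there exists an invertible matrix $P$ such that for all $y_1,y_2$, $$P\,\partial_{y_2}v(y_1,y_2)P^{-1}=-\partial_{y_2}v(y_1,y_2),\qquad P\,\partial_{y_2}g_2(y_1,y_2)P^{-1}=-\partial_{y_2}g_2(y_1,y_2).$$ Then the SSEI method is volume preserving for the vector fields $f(y_1,y_2)=(u(y_1),v(y_1,y_2))^{\intercal}$ in $\mathcal F^{(2)}$ (applied to $y'=f(y)=Ky+g(y)$ with $K=\mathrm{diag}(K_{11},K_{22})$ and $g(y)=(g_1(y_1),g_2(y_1,y_2))^{\intercal}$).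
   Context: $|\cdot|$ denotes the determinant. For an ODE $y'=Ky+g(y)=:f(y)$ on $\mathbb{R}^d$ ($K$ a real $d\times d$ matrix with $|e^{hK}|\ne-1$ for $0<h<1$, $g$ differentiable, $f$ divergence free), an $s$-stage SSEI (special symplectic exponential integrator) method with stepsize $h$ is the map $$\varphi_h(y)=e^{hK}y+h\sum_{i=1}^{s}b_ie^{(1-c_i)hK}g(k_i(y)),\qquad k_i(y)=e^{c_ihK}y+h\sum_{j=1}^{s}a_{ij}e^{(c_i-c_j)hK}g(k_j(y)),\quad i=1,\dots,s,$$ where $c=(c_i)$, $b=(b_i)$, $A=(a_{ij})$ are the coefficients of an $s$-stage Runge--Kutta method which is symplectic ($b_ia_{ij}+b_ja_{ji}-b_ib_j=0$ for all $i,j$) and satisfies $b_j\neq0$ for all $j$. It is understood that the stage equations define $k_1,\dots,k_s$ as differentiable functions of $y$ and that the block matrix with blocks $\delta_{ij}I-h\,a_{ij}e^{(c_i-c_j)hK}g'(k_j)$ is invertible. A method is volume preserving if its one-step map has Jacobian determinant $1$ at every $y$. Classes of vector fields: $\mathcal H$ (resp. $\mathcal S$) is the set of $f$ for which there exists an invertible matrix $P$ with $Pf'(y)P^{-1}=-f'(y)^{\intercal}$ (resp. $Pf'(y)P^{-1}=-f'(y)$) for all $y$. $\mathcal F^{(2)}$ is defined recursively as the set of vector fields $f(y_1,y_2)=(u(y_1),v(y_1,y_2))^{\intercal}$ with $u\in\mathcal H\cup\mathcal S\cup\mathcal F^{(2)}$ for which there exists an invertible $P$ such that for all $y_1,y_2$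 either $P\,\partial_{y_2}v(y_1,y_2)P^{-1}=-\partial_{y_2}v(y_1,y_2)^{\intercal}$ or $P\,\partial_{y_2}v(y_1,y_2)P^{-1}=-\partial_{y_2}v(y_1,y_2)$. *)

theory Defs
  imports "HOL-Analysis.Analysis" "HOL-Library.Numeral_Type"
begin

section \<open>Matrix exponential\<close>

(* real^'d^'d carries the componentwise product, so the library's exp and power do not give
   the matrix exponential. *)
definition mat_exp :: "real^'d^'d \<Rightarrow> real^'d^'d" where
  "mat_exp A = (\<Sum>n. (1 / fact n) *\<^sub>R (((**) A ^^ n) (mat 1)))"

section \<open>SSEI methods\<close>

record ('s::finite) rk_tableau =
  rk_a :: "'s \<Rightarrow> 's \<Rightarrow> real"
  rk_b :: "'s \<Rightarrow> real"
  rk_c :: "'s \<Rightarrow> real"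

definition ssei_coeffs :: "('s::finite) rk_tableau \<Rightarrow> bool" where
  "ssei_coeffs T \<longleftrightarrow>
     (\<forall>i j. rk_b T i * rk_a T i j + rk_b T j * rk_a T j i - rk_b T i * rk_b T j = 0) \<and>
     (\<forall>j. rk_b T j \<noteq> 0)"

(* The standing assumptions on the equation y' = K y + g(y).  The divergence of a vector field
   is the trace of its Jacobian. *)
definition ssei_problem :: "real^'d^'d \<Rightarrow> (real^'d \<Rightarrow> real^'d) \<Rightarrow> bool" where
  "ssei_problem K g \<longleftrightarrow>
     (\<forall>h. 0 < h \<and> h < 1 \<longrightarrow> det (mat_exp (h *\<^sub>R K)) \<noteq> -1) \<and>
     (\<forall>y. g differentiable (at y)) \<and>
     (\<forall>y. trace (jacobian (\<lambda>z. K *v z + g z) (at y)) = 0)"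

(* k $ i is the i-th stage. *)
definition ssei_stage_eqs ::
  "('s::finite) rk_tableau \<Rightarrow> real \<Rightarrow> real^'d^'d \<Rightarrow> (real^'d \<Rightarrow> real^'d) \<Rightarrow> real^'d \<Rightarrow> real^'d^'s \<Rightarrow> bool"
where
  "ssei_stage_eqs T h K g y k \<longleftrightarrow>
     (\<forall>i. k $ i = mat_exp ((rk_c T i * h) *\<^sub>R K) *v y +
            h *\<^sub>R (\<Sum>j\<in>UNIV. rk_a T i j *\<^sub>R
                    (mat_exp (((rk_c T i - rk_c T j) * h) *\<^sub>R K) *v g (k $ j))))"

definition ssei_stages ::
  "('s::finite) rk_tableau \<Rightarrow> real \<Rightarrow> real^'d^'d \<Rightarrow> (real^'d \<Rightarrow> real^'d) \<Rightarrow> real^'d \<Rightarrow> real^'d^'s"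
where
  "ssei_stages T h K g y = (THE k. ssei_stage_eqs T h K g y k)"

definition ssei_block_matrix ::
  "('s::finite) rk_tableau \<Rightarrow> real \<Rightarrow> real^'d^'d \<Rightarrow> (real^'d \<Rightarrow> real^'d) \<Rightarrow> real^'d^'s
     \<Rightarrow> real^('s \<times> 'd)^('s \<times> 'd)"
where
  "ssei_block_matrix T h K g k = (\<chi> p q.
     ((if fst p = fst q then mat 1 else 0)
       - (h * rk_a T (fst p) (fst q)) *\<^sub>R
           (mat_exp (((rk_c T (fst p) - rk_c T (fst q)) * h) *\<^sub>R K)
             ** jacobian g (at (k $ fst q)))) $ snd p $ snd q)"

definition ssei_well_posed ::
  "('s::finite) rk_tableau \<Rightarrow> real \<Rightarrow> real^'d^'d \<Rightarrow> (real^'d \<Rightarrow> real^'d) \<Rightarrow> bool"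
where
  "ssei_well_posed T h K g \<longleftrightarrow>
     (\<forall>y. \<exists>!k. ssei_stage_eqs T h K g y k) \<and>
     (\<forall>y. ssei_stages T h K g differentiable (at y)) \<and>
     (\<forall>y. invertible (ssei_block_matrix T h K g (ssei_stages T h K g y)))"

definition ssei_map ::
  "('s::finite) rk_tableau \<Rightarrow> real \<Rightarrow> real^'d^'d \<Rightarrow> (real^'d \<Rightarrow> real^'d) \<Rightarrow> real^'d \<Rightarrow> real^'d"
where
  "ssei_map T h K g y = mat_exp (h *\<^sub>R K) *v y +
     h *\<^sub>R (\<Sum>i\<in>UNIV. rk_b T i *\<^sub>R
             (mat_exp (((1 - rk_c T i) * h) *\<^sub>R K) *v g (ssei_stages T h K g y $ i)))"

definition volume_preserving :: "(real^'d \<Rightarrow> real^'d) \<Rightarrow> bool" where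
  "volume_preserving \<phi> \<longleftrightarrow> (\<forall>y. \<phi> differentiable (at y) \<and> det (jacobian \<phi> (at y)) = 1)"

section \<open>Compositions of one-stage and two-stage methods\<close>

datatype small_ssei = OneStage "1 rk_tableau" | TwoStage "2 rk_tableau"

fun small_ssei_coeffs :: "small_ssei \<Rightarrow> bool" where
  "small_ssei_coeffs (OneStage T) \<longleftrightarrow> ssei_coeffs T"
| "small_ssei_coeffs (TwoStage T) \<longleftrightarrow> ssei_coeffs T \<and> rk_c T 1 = rk_c T 2"

fun small_ssei_well_posed ::
  "real^'d^'d \<Rightarrow> (real^'d \<Rightarrow> real^'d) \<Rightarrow> small_ssei \<times> real \<Rightarrow> bool" where
  "small_ssei_well_posed K g (OneStage T, h) \<longleftrightarrow> ssei_well_posed T h K g"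
| "small_ssei_well_posed K g (TwoStage T, h) \<longleftrightarrow> ssei_well_posed T h K g"

fun small_ssei_map ::
  "real^'d^'d \<Rightarrow> (real^'d \<Rightarrow> real^'d) \<Rightarrow> small_ssei \<times> real \<Rightarrow> real^'d \<Rightarrow> real^'d" where
  "small_ssei_map K g (OneStage T, h) = ssei_map T h K g"
| "small_ssei_map K g (TwoStage T, h) = ssei_map T h K g"

(* A composition is a list of methods, each with its own stepsize; the head of the list is
   applied first.  Stepsizes are arbitrary reals, since compositions of higher order use
   negative substeps.  A single method with stepsize h is the list [(M, h)]. *)
fun composition_map ::
  "real^'d^'d \<Rightarrow> (real^'d \<Rightarrow> real^'d) \<Rightarrow> (small_ssei \<times> real) list \<Rightarrow> real^'d \<Rightarrow> real^'d" where
  "composition_map K g [] = id"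
| "composition_map K g (s # ss) = composition_map K g ss \<circ> small_ssei_map K g s"

section \<open>Classes of vector fields\<close>

(* The second class is recursive in the dimension, and types cannot be quantified inside a
   definition.  So R^J, for a set J of coordinates, is realised as the vectors of real^'d
   supported on J, and the J-by-J matrices as the matrices supported on J times J, with unit
   block J (mat 1).  A vector field on R^J is extended constantly in the other coordinates;
   its Jacobian is then supported on J times J.  J = UNIV gives the vector fields on real^'d.
   The coordinates have no order, so the blocks (y1, y2) are given by any partition. *)

definition restr :: "'d set \<Rightarrow> real^'d \<Rightarrow> real^'d" where
  "restr J x = (\<chi> i. if i \<in> J then x $ i else 0)"

definition block :: "'d set \<Rightarrow> real^'d^'d \<Rightarrow> real^'d^'d" where
  "block J A = (\<chi> i j. if i \<in> J \<and> j \<in> J then A $ i $ j else 0)"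

definition vector_field_on :: "'d set \<Rightarrow> (real^'d \<Rightarrow> real^'d) \<Rightarrow> bool" where
  "vector_field_on J f \<longleftrightarrow>
     (\<forall>y. f y = restr J (f (restr J y))) \<and> (\<forall>y. f differentiable (at y))"

(* P is an invertible J-by-J matrix with inverse Q. *)
definition inverse_pair_on :: "'d set \<Rightarrow> real^'d^'d \<Rightarrow> real^'d^'d \<Rightarrow> bool" where
  "inverse_pair_on J P Q \<longleftrightarrow>
     P = block J P \<and> Q = block J Q \<and> P ** Q = block J (mat 1) \<and> Q ** P = block J (mat 1)"

definition class_H :: "'d set \<Rightarrow> (real^'d \<Rightarrow> real^'d) \<Rightarrow> bool" where
  "class_H J f \<longleftrightarrow> vector_field_on J f \<and>
     (\<exists>P Q. inverse_pair_on J P Q \<and>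
        (\<forall>y. P ** jacobian f (at y) ** Q = - transpose (jacobian f (at y))))"

definition class_S :: "'d set \<Rightarrow> (real^'d \<Rightarrow> real^'d) \<Rightarrow> bool" where
  "class_S J f \<longleftrightarrow> vector_field_on J f \<and>
     (\<exists>P Q. inverse_pair_on J P Q \<and>
        (\<forall>y. P ** jacobian f (at y) ** Q = - jacobian f (at y)))"

(* Here y1 = restr J y and y2 = restr L y; only the values of v on R^J times R^L matter, and
   partial y1 y2 is the derivative of v(y1, y2) with respect to y2. *)
inductive class_F2 :: "'d set \<Rightarrow> (real^'d \<Rightarrow> real^'d) \<Rightarrow> bool" where
  "\<lbrakk> J \<inter> L = {}; J \<noteq> {}; L \<noteq> {};
     class_H J u \<or> class_S J u \<or> class_F2 J u;
     \<forall>y1 y2. v y1 y2 = restr L (v (restr J y1) (restr L y2));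
     f = (\<lambda>y. u (restr J y) + v (restr J y) (restr L y));
     vector_field_on (J \<union> L) f;
     partial = (\<lambda>y1 y2. jacobian (\<lambda>z. v y1 z) (at y2));
     inverse_pair_on L P Q;
     \<forall>y1 y2. P ** partial y1 y2 ** Q = - transpose (partial y1 y2) \<or>
             P ** partial y1 y2 ** Q = - partial y1 y2 \<rbrakk>
   \<Longrightarrow> class_F2 (J \<union> L) f"

lemma inverse_pair_on_UNIV:
  "inverse_pair_on UNIV P Q \<longleftrightarrow> P ** Q = mat 1 \<and> Q ** P = mat 1"
  by (simp add: inverse_pair_on_def block_def)

lemma inverse_pair_on_UNIV_iff_inv:
  fixes P :: "real^'d^'d"
  shows "inverse_pair_on UNIV P Q \<longleftrightarrow> invertible P \<and> Q = matrix_inv P"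
proof -
  have inv: "P ** matrix_inv P = mat 1 \<and> matrix_inv P ** P = mat 1" if "invertible P"
    using that unfolding invertible_def matrix_inv_def by (rule someI_ex)
  moreover have "Q = matrix_inv P" if "P ** Q = mat 1" "Q ** P = mat 1"
    using that inv by (metis invertible_def matrix_mul_assoc matrix_mul_lid matrix_mul_rid)
  ultimately show ?thesis
    unfolding inverse_pair_on_UNIV by (metis invertible_def)
qed

lemma class_H_UNIV:
  "class_H UNIV f \<longleftrightarrow> (\<forall>y. f differentiable (at y)) \<and>
     (\<exists>P. invertible P \<and> (\<forall>y. P ** jacobian f (at y) ** matrix_inv P = - transpose (jacobian f (at y))))"
  by (auto simp: class_H_def vector_field_on_def inverse_pair_on_UNIV_iff_inv restr_def)

lemma class_S_UNIV:
  "class_S UNIV f \<longleftrightarrow> (\<forall>y. f differentiable (at y)) \<and>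
     (\<exists>P. invertible P \<and> (\<forall>y. P ** jacobian f (at y) ** matrix_inv P = - jacobian f (at y)))"
  by (auto simp: class_S_def vector_field_on_def inverse_pair_on_UNIV_iff_inv restr_def)

section \<open>Block vectors\<close>

(* real^('m + 'n) is R^(m+n), with first block indexed by Inl and second block by Inr. *)
definition join :: "real^'m \<Rightarrow> real^'n \<Rightarrow> real^('m + 'n)" where
  "join y1 y2 = (\<chi> k. case k of Inl i \<Rightarrow> y1 $ i | Inr j \<Rightarrow> y2 $ j)"

definition fst_block :: "real^('m::finite + 'n::finite) \<Rightarrow> real^'m" where
  "fst_block y = (\<chi> i. y $ Inl i)"

definition snd_block :: "real^('m::finite + 'n::finite) \<Rightarrow> real^'n" where
  "snd_block y = (\<chi> j. y $ Inr j)"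

definition block_diag :: "real^'m^'m \<Rightarrow> real^'n^'n \<Rightarrow> real^('m + 'n)^('m + 'n)" where
  "block_diag A B = (\<chi> p q. case (p, q) of (Inl i, Inl j) \<Rightarrow> A $ i $ j
                                    | (Inr i, Inr j) \<Rightarrow> B $ i $ j | _ \<Rightarrow> 0)"

end

theory Submission
  imports Defs
begin

text \<open>
  The vector field is triangular, and so is the method applied to it: because the matrix
  exponential of a block diagonal matrix is block diagonal, the first blocks of the stages
  satisfy the stage equations of the method for \<open>u\<close>, hence are its stages by uniqueness.
  The Jacobian of one step is therefore block lower triangular.  Its first diagonal block is the
  Jacobian of the step for \<open>u\<close>, and it remains to see that the second diagonal
  block \<open>D\<close>, the derivative of the second component in \<open>y2\<close>, has determinant 1
  in every single step.  Then the determinants of the composition for \<open>f\<close> and of the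
  composition for \<open>u\<close> agree, although the individual steps for \<open>u\<close> need not
  preserve volume.

  For equal nodes \<open>c\<close>, the second component is a Runge--Kutta step between two
  propagators, so \<open>D = Y U X\<close> with \<open>X = exp (c h K22)\<close>,
  \<open>Y = exp ((1 - c) h K22)\<close>.  Conjugation by \<open>P\<close> turns \<open>K22\<close> into its
  negative, so \<open>exp (h K22)\<close> has the same determinant as its inverse; being the square of
  \<open>exp (h K22 / 2)\<close>, it has determinant 1 (\<open>det_mat_exp_eq_1\<close>).

  For the Runge--Kutta factor \<open>U\<close>, let \<open>N(A)\<close> be the block matrix with
  blocks \<open>\<delta>_ij I - h a_ij G_j\<close>, where \<open>G_j\<close> is the derivative of \<open>g2\<close> in
  \<open>y2\<close> at the \<open>j\<close>-th stage.  As \<open>N(A)\<close> is invertible, four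
  determinant identities give \<open>det U = 1\<close>:
  \<^item> \<open>det N(A) det U = det N(A - 1 b^T)\<close>, by Sylvester's identity
    (\<open>det_stage_matrix_update\<close>);
  \<^item> symplecticity says \<open>A - 1 b^T = - B^(-1) A^T B\<close> with \<open>B = diag b\<close>, so
    \<open>det N(A - 1 b^T) = det N(- A^T)\<close>;
  \<^item> conjugation by \<open>P\<close> changes the sign of all \<open>G_j\<close>, so
    \<open>det N(- A^T) = det N(A^T)\<close> (together with the previous item:
    \<open>det_stage_matrix_adjoint\<close>);
  \<^item> \<open>det N(A^T) = det N(A)\<close> for at most two stages, since the determinant depends on the
    two off-diagonal coefficients through their product only
    (\<open>det_stage_matrix_transpose_2\<close>).

  Thus the bound on the number of stages enters through the last identity only, and the equality
  of the nodes through the factorisation \<open>D = Y U X\<close>.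
\<close>

section \<open>The matrix exponential\<close>

lemma bounded_bilinear_matrix_mult:
  "bounded_bilinear ((**) :: real^'m^'k \<Rightarrow> real^'n^'m \<Rightarrow> real^'n^'k)"
proof -
  have "bilinear ((**) :: real^'m^'k \<Rightarrow> real^'n^'m \<Rightarrow> real^'n^'k)"
    unfolding bilinear_def
    by (auto intro!: linearI simp: matrix_matrix_mult_def vec_eq_iff sum.distrib sum_distrib_left algebra_simps)
  then show ?thesis
    by (simp add: bilinear_conv_bounded_bilinear)
qed

lemmas matrix_mult_simps =
  bounded_bilinear.add_left[OF bounded_bilinear_matrix_mult]
  bounded_bilinear.add_right[OF bounded_bilinear_matrix_mult]
  bounded_bilinear.diff_left[OF bounded_bilinear_matrix_mult]
  bounded_bilinear.diff_right[OF bounded_bilinear_matrix_mult]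
  bounded_bilinear.minus_left[OF bounded_bilinear_matrix_mult]
  bounded_bilinear.minus_right[OF bounded_bilinear_matrix_mult]
  bounded_bilinear.zero_left[OF bounded_bilinear_matrix_mult]
  bounded_bilinear.zero_right[OF bounded_bilinear_matrix_mult]
  bounded_bilinear.scaleR_left[OF bounded_bilinear_matrix_mult]
  bounded_bilinear.scaleR_right[OF bounded_bilinear_matrix_mult]
  bounded_bilinear.sum_left[OF bounded_bilinear_matrix_mult]
  bounded_bilinear.sum_right[OF bounded_bilinear_matrix_mult]

definition mat_pow :: "real^'d^'d \<Rightarrow> nat \<Rightarrow> real^'d^'d" where
  "mat_pow A n = ((**) A ^^ n) (mat 1)"

lemma mat_pow_0 [simp]: "mat_pow A 0 = mat 1"
  and mat_pow_Suc: "mat_pow A (Suc n) = A ** mat_pow A n"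
  by (simp_all add: mat_pow_def)

lemma mat_pow_add: "mat_pow A (m + n) = mat_pow A m ** mat_pow A n"
  by (induction m) (simp_all add: mat_pow_Suc matrix_mul_assoc)

lemma mat_pow_scaleR: "mat_pow (r *\<^sub>R A) n = r ^ n *\<^sub>R mat_pow A n"
  by (induction n) (simp_all add: mat_pow_Suc matrix_mult_simps)

lemma mat_pow_intertwine:
  fixes R :: "real^'a^'b"
  assumes "R ** A = B ** R"
  shows "R ** mat_pow A n = mat_pow B n ** R"
proof (induction n)
  case (Suc n)
  have "R ** mat_pow A (Suc n) = B ** (R ** mat_pow A n)"
    by (simp add: mat_pow_Suc matrix_mul_assoc assms)
  then show ?case
    by (simp add: Suc mat_pow_Suc matrix_mul_assoc)
qed simp

lemma summable_norm_mat_exp: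
  fixes A :: "real^'a^'a"
  shows "summable (\<lambda>n. norm ((1 / fact n) *\<^sub>R mat_pow A n))"
proof -
  obtain C where C: "\<And>(X :: real^'a^'a) (Y :: real^'a^'a). norm (X ** Y) \<le> norm X * norm Y * C" "C > 0"
    using bounded_bilinear.pos_bounded[OF bounded_bilinear_matrix_mult] by blast
  have bound: "norm (mat_pow A n) \<le> norm (mat 1 :: real^'a^'a) * (norm A * C) ^ n" for n
  proof (induction n)
    case (Suc n)
    have "norm (mat_pow A (Suc n)) \<le> norm A * norm (mat_pow A n) * C"
      unfolding mat_pow_Suc by (rule C(1))
    also have "\<dots> \<le> norm A * (norm (mat 1 :: real^'a^'a) * (norm A * C) ^ n) * C"
      using Suc C(2) by (intro mult_right_mono mult_left_mono) auto
    finally show ?case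
      by (simp add: algebra_simps)
  qed simp
  have "summable (\<lambda>n. norm (mat 1 :: real^'a^'a) * (inverse (fact n) * (norm A * C) ^ n))"
    by (intro summable_mult summable_exp)
  then show ?thesis
  proof (rule summable_comparison_test')
    fix n
    have "norm (norm ((1 / fact n) *\<^sub>R mat_pow A n)) = inverse (fact n) * norm (mat_pow A n)"
      by (simp add: field_simps)
    also have "\<dots> \<le> inverse (fact n) * (norm (mat 1 :: real^'a^'a) * (norm A * C) ^ n)"
      using bound by (intro mult_left_mono) auto
    finally show "norm (norm ((1 / fact n) *\<^sub>R mat_pow A n))
        \<le> norm (mat 1 :: real^'a^'a) * (inverse (fact n) * (norm A * C) ^ n)"
      by (simp add: algebra_simps)
  qed
qed

lemma mat_exp_sums: "(\<lambda>n. (1 / fact n) *\<^sub>R mat_pow A n) sums mat_exp A"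
  unfolding mat_exp_def mat_pow_def[symmetric]
  by (intro summable_sums summable_norm_cancel[OF summable_norm_mat_exp])

lemma mat_exp_0: "mat_exp 0 = mat 1"
proof -
  have "(\<lambda>n. (1 / fact n) *\<^sub>R mat_pow (0 :: real^'a^'a) n) sums (\<Sum>n\<in>{0}. (1 / fact n) *\<^sub>R mat_pow 0 n)"
    by (rule sums_finite) (auto simp: mat_pow_Suc matrix_mult_simps gr0_conv_Suc)
  from sums_unique2[OF mat_exp_sums this] show ?thesis
    by simp
qed

text \<open>
  Rectangular \<open>R\<close> are allowed because two kinds of matrices are used: a square one that
  conjugates \<open>A\<close> to its negative, and the projections onto the blocks of a block diagonal
  matrix.
\<close>

lemma mat_exp_intertwine:
  fixes R :: "real^'a^'b"
  assumes "R ** A = B ** R"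
  shows "R ** mat_exp A = mat_exp B ** R"
proof -
  have "(\<lambda>n. R ** ((1 / fact n) *\<^sub>R mat_pow A n)) sums (R ** mat_exp A)"
    by (intro bounded_linear.sums[OF bounded_bilinear.bounded_linear_right[OF bounded_bilinear_matrix_mult]]
        mat_exp_sums)
  moreover have "(\<lambda>n. ((1 / fact n) *\<^sub>R mat_pow B n) ** R) sums (mat_exp B ** R)"
    by (intro bounded_linear.sums[OF bounded_bilinear.bounded_linear_left[OF bounded_bilinear_matrix_mult]]
        mat_exp_sums)
  ultimately show ?thesis
    by (simp add: matrix_mult_simps mat_pow_intertwine[OF assms] sums_unique2)
qed

lemma mat_exp_entry_sums:
  "(\<lambda>n. s ^ n / fact n * mat_pow A n $ i $ j) sums mat_exp (s *\<^sub>R A) $ i $ j"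
  using bounded_linear.sums[OF bounded_linear_vec_nth
      bounded_linear.sums[OF bounded_linear_vec_nth mat_exp_sums[of "s *\<^sub>R A"]], of i j]
  by (simp add: mat_pow_scaleR)

lemma summable_norm_mat_exp_entry: "summable (\<lambda>n. norm (s ^ n / fact n * mat_pow A n $ i $ j))"
proof (rule summable_comparison_test'[OF summable_norm_mat_exp[of "s *\<^sub>R A"]])
  fix n
  have "norm (s ^ n / fact n * mat_pow A n $ i $ j) = norm (((1 / fact n) *\<^sub>R mat_pow (s *\<^sub>R A) n) $ i $ j)"
    by (simp add: mat_pow_scaleR)
  also have "\<dots> \<le> norm ((1 / fact n) *\<^sub>R mat_pow (s *\<^sub>R A) n)"
    by (rule order_trans[OF Finite_Cartesian_Product.norm_nth_le Finite_Cartesian_Product.norm_nth_le])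
  finally show "norm (norm (s ^ n / fact n * mat_pow A n $ i $ j)) \<le> norm ((1 / fact n) *\<^sub>R mat_pow (s *\<^sub>R A) n)"
    by simp
qed

text \<open>
  The Cauchy product is taken of the real series of the entries, since the algebra product on the
  type of matrices is the componentwise one; the binomial theorem collects the result.
\<close>

lemma mat_exp_add: "mat_exp ((s + t) *\<^sub>R A) = mat_exp (s *\<^sub>R A) ** mat_exp (t *\<^sub>R A)"
proof -
  have "mat_exp ((s + t) *\<^sub>R A) $ i $ j = (mat_exp (s *\<^sub>R A) ** mat_exp (t *\<^sub>R A)) $ i $ j" for i j
  proof -
    let ?a = "\<lambda>r n k l. r ^ n / fact n * mat_pow A n $ k $ l"
    have "(\<lambda>n. \<Sum>k\<in>UNIV. \<Sum>m\<le>n. ?a s m i k * ?a t (n - m) k j)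
        sums (\<Sum>k\<in>UNIV. (\<Sum>n. ?a s n i k) * (\<Sum>n. ?a t n k j))"
      by (intro sums_sum Cauchy_product_sums summable_norm_mat_exp_entry)
    moreover have "(\<Sum>k\<in>UNIV. (\<Sum>n. ?a s n i k) * (\<Sum>n. ?a t n k j))
        = (mat_exp (s *\<^sub>R A) ** mat_exp (t *\<^sub>R A)) $ i $ j"
      by (simp only: sums_unique[OF mat_exp_entry_sums, symmetric]) (simp add: matrix_matrix_mult_def)
    moreover have "(\<Sum>k\<in>UNIV. \<Sum>m\<le>n. ?a s m i k * ?a t (n - m) k j) = ?a (s + t) n i j" for n
    proof -
      have "(\<Sum>k\<in>UNIV. \<Sum>m\<le>n. ?a s m i k * ?a t (n - m) k j)
          = (\<Sum>m\<le>n. s ^ m / fact m * (t ^ (n - m) / fact (n - m)) * (mat_pow A m ** mat_pow A (n - m)) $ i $ j)"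
        by (subst sum.swap) (simp add: matrix_matrix_mult_def sum_distrib_left mult_ac)
      also have "\<dots> = (\<Sum>m\<le>n. of_nat (n choose m) * s ^ m * t ^ (n - m) / fact n * mat_pow A n $ i $ j)"
        by (intro sum.cong refl) (simp add: mat_pow_add[symmetric] binomial_fact)
      also have "\<dots> = ?a (s + t) n i j"
        by (simp add: binomial_ring sum_distrib_right sum_divide_distrib)
      finally show ?thesis .
    qed
    ultimately have "(\<lambda>n. ?a (s + t) n i j) sums (mat_exp (s *\<^sub>R A) ** mat_exp (t *\<^sub>R A)) $ i $ j"
      by (simp only:)
    then show ?thesis
      by (rule sums_unique2[OF mat_exp_entry_sums])
  qed
  then show ?thesis
    by (simp add: vec_eq_iff)
qed

lemma
  fixes P :: "real^'n^'n"
  assumes "invertible P"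
  shows mult_matrix_inv: "P ** matrix_inv P = mat 1" and matrix_inv_mult: "matrix_inv P ** P = mat 1"
  using inverse_pair_on_UNIV_iff_inv[of P "matrix_inv P"] assms by (simp_all add: inverse_pair_on_UNIV)

lemma conj_eq_minus_iff:
  fixes P :: "real^'n^'n"
  assumes "invertible P"
  shows "P ** A ** matrix_inv P = - A \<longleftrightarrow> P ** A = - A ** P"
proof -
  note inv = mult_matrix_inv[OF assms] matrix_inv_mult[OF assms]
  show ?thesis
  proof
    assume "P ** A ** matrix_inv P = - A"
    then have "P ** A ** matrix_inv P ** P = - A ** P" by simp
    then show "P ** A = - A ** P"
      by (simp add: matrix_mul_assoc[symmetric] inv)
  next
    assume "P ** A = - A ** P"
    then show "P ** A ** matrix_inv P = - A"
      by (simp add: matrix_mul_assoc[symmetric] inv)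
  qed
qed

text \<open>
  Conjugation by \<open>P\<close> maps the exponential to its inverse, so its determinant is 1 or -1.
  The value -1 is excluded because the exponential is a square.
\<close>

lemma det_mat_exp_eq_1:
  fixes P K :: "real^'n^'n"
  assumes "invertible P" and anti: "P ** K = - K ** P"
  shows "det (mat_exp (h *\<^sub>R K)) = 1"
proof -
  have "P ** mat_exp (h *\<^sub>R K) = mat_exp ((- h) *\<^sub>R K) ** P"
    by (rule mat_exp_intertwine) (simp add: matrix_mult_simps anti)
  then have "det P * det (mat_exp (h *\<^sub>R K)) = det (mat_exp ((- h) *\<^sub>R K)) * det P"
    by (metis det_mul)
  then have "det (mat_exp (h *\<^sub>R K)) = det (mat_exp ((- h) *\<^sub>R K))"
    using assms(1) by (simp add: invertible_det_nz)
  moreover have "det (mat_exp (h *\<^sub>R K)) * det (mat_exp ((- h) *\<^sub>R K)) = 1"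
    using arg_cong[OF mat_exp_add[of h "- h" K], of det] by (simp add: det_mul mat_exp_0)
  ultimately have "det (mat_exp (h *\<^sub>R K)) ^ 2 = 1"
    by (simp add: power2_eq_square)
  then have "det (mat_exp (h *\<^sub>R K)) = 1 \<or> det (mat_exp (h *\<^sub>R K)) = - 1"
    by (simp only: power2_eq_1_iff)
  moreover have "0 \<le> det (mat_exp (h *\<^sub>R K))"
    using arg_cong[OF mat_exp_add[of "h / 2" "h / 2" K], of det] by (simp add: det_mul)
  ultimately show ?thesis
    by linarith
qed

section \<open>Determinants of block matrices\<close>

definition four_block ::
  "real^'a^'a \<Rightarrow> real^'b^'a \<Rightarrow> real^'a^'b \<Rightarrow> real^'b^'b \<Rightarrow> real^('a + 'b)^('a + 'b)" where
  "four_block A B C D = (\<chi> p q.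
     case p of
       Inl i \<Rightarrow> (case q of Inl j \<Rightarrow> A $ i $ j | Inr j \<Rightarrow> B $ i $ j)
     | Inr i \<Rightarrow> (case q of Inl j \<Rightarrow> C $ i $ j | Inr j \<Rightarrow> D $ i $ j))"

lemma four_block_nth [simp]:
  "four_block A B C D $ Inl i $ Inl j = A $ i $ j"
  "four_block A B C D $ Inl i $ Inr l = B $ i $ l"
  "four_block A B C D $ Inr k $ Inl j = C $ k $ j"
  "four_block A B C D $ Inr k $ Inr l = D $ k $ l"
  by (simp_all add: four_block_def)

lemma forall_sum: "(\<forall>p. Q p) \<longleftrightarrow> (\<forall>i. Q (Inl i)) \<and> (\<forall>j. Q (Inr j))"
  by (metis sum.exhaust)

lemma sum_UNIV_Plus:
  fixes f :: "'a::finite + 'b::finite \<Rightarrow> real"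
  shows "sum f UNIV = (\<Sum>i\<in>UNIV. f (Inl i)) + (\<Sum>j\<in>UNIV. f (Inr j))"
  using sum.Plus[of "UNIV :: 'a set" "UNIV :: 'b set" f] by simp

lemma four_block_mult:
  "four_block A B C D ** four_block A' B' C' D' =
     four_block (A ** A' + B ** C') (A ** B' + B ** D') (C ** A' + D ** C') (C ** B' + D ** D')"
  by (simp add: vec_eq_iff forall_sum matrix_matrix_mult_def sum_UNIV_Plus)

lemma four_block_mat_1: "four_block (mat 1) 0 0 (mat 1) = mat 1"
  by (simp add: vec_eq_iff forall_sum mat_def)

text \<open>
  The matrix \<open>A\<close> on the indices in the range of \<open>f\<close>, and the identity on the
  others.  With \<open>f\<close> equal to \<open>Inl\<close> or \<open>Inr\<close> this gives both kinds of block diagonal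
  matrices in which one block is the identity.
\<close>

definition embed_matrix :: "('a \<Rightarrow> 'c) \<Rightarrow> real^'a^'a \<Rightarrow> real^'c^'c" where
  "embed_matrix f A =
     (\<chi> p q. if p \<in> range f \<and> q \<in> range f then A $ inv f p $ inv f q else mat 1 $ p $ q)"

lemma embed_matrix_mult:
  assumes "inj f"
  shows "embed_matrix f (A ** B) = embed_matrix f A ** embed_matrix f B"
proof -
  have "embed_matrix f (A ** B) $ p $ q = (embed_matrix f A ** embed_matrix f B) $ p $ q" for p q
  proof (cases "p \<in> range f")
    case True
    then obtain i where p: "p = f i"
      by blast
    have "(\<Sum>r\<in>UNIV. embed_matrix f A $ p $ r * embed_matrix f B $ r $ q)
        = (\<Sum>r\<in>range f. embed_matrix f A $ p $ r * embed_matrix f B $ r $ q)"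
      by (rule sum.mono_neutral_right) (auto simp: embed_matrix_def mat_def p)
    also have "\<dots> = (\<Sum>k\<in>UNIV. A $ i $ k * embed_matrix f B $ f k $ q)"
      by (subst sum.reindex[OF assms]) (simp add: embed_matrix_def p assms)
    finally show ?thesis
      using assms
      by (auto simp: matrix_matrix_mult_def embed_matrix_def[of f "A ** B"] p)
        (auto simp: embed_matrix_def mat_def intro!: sum.neutral)
  next
    case False
    have "(\<Sum>r\<in>UNIV. embed_matrix f A $ p $ r * embed_matrix f B $ r $ q)
        = (\<Sum>r\<in>{p}. embed_matrix f A $ p $ r * embed_matrix f B $ r $ q)"
      using False by (intro sum.mono_neutral_right) (auto simp: embed_matrix_def mat_def)
    then show ?thesis
      using False by (simp add: matrix_matrix_mult_def embed_matrix_def mat_def)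
  qed
  then show ?thesis
    by (simp add: vec_eq_iff)
qed

text \<open>
  Every square matrix is a product of diagonal matrices, transpositions, shears and matrices with
  a zero row, and the embedding is multiplicative and sends each of them to one of the same kind.
\<close>

lemma det_embed_matrix:
  fixes f :: "'a::finite \<Rightarrow> 'c::finite" and A :: "real^'a^'a"
  assumes "inj f"
  shows "det (embed_matrix f A) = det A"
proof (induction A rule: induct_matrix_elementary)
  case (1 A B)
  then show ?case
    by (simp add: embed_matrix_mult assms det_mul)
next
  case (2 A i)
  then have "row (f i) (embed_matrix f A) = 0"
    by (auto simp: vec_eq_iff row_def embed_matrix_def mat_def assms)
  then show ?case
    using 2 by (simp add: det_zero_row)
next
  case (3 A)
  have "det (embed_matrix f A) = (\<Prod>p\<in>UNIV. embed_matrix f A $ p $ p)"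
    by (rule det_diagonal) (use 3 assms in \<open>auto simp: embed_matrix_def mat_def, metis\<close>)
  also have "\<dots> = (\<Prod>p\<in>range f. embed_matrix f A $ p $ p)"
    by (rule prod.mono_neutral_right) (auto simp: embed_matrix_def mat_def)
  also have "\<dots> = (\<Prod>i\<in>UNIV. A $ i $ i)"
    by (subst prod.reindex[OF assms]) (simp add: embed_matrix_def assms)
  finally show ?case
    using 3 by (simp add: det_diagonal)
next
  case (4 m n)
  let ?t = "Transposition.transpose (f m) (f n)"
  have "embed_matrix f (\<chi> i j. mat 1 $ i $ Transposition.transpose m n j) = (\<chi> p q. mat 1 $ p $ ?t q)"
    using assms by (auto simp: vec_eq_iff embed_matrix_def mat_def Transposition.transpose_def inj_eq[OF assms])
  moreover have "?t permutes UNIV" "Transposition.transpose m n permutes UNIV"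
    by (simp_all add: permutes_swap_id)
  ultimately show ?case
    using 4 assms by (simp add: det_permute_columns sign_swap_id inj_eq[OF assms])
next
  case (5 m n c)
  let ?E = "(\<chi> i j. if i = m \<and> j = n then c else of_bool (i = j)) :: real^'a^'a"
  have "embed_matrix f ?E
      = (\<chi> p. if p = f m then row (f m) (mat 1) + c *s row (f n) (mat 1) else row p (mat 1))"
    using 5 assms by (auto simp: vec_eq_iff embed_matrix_def mat_def row_def inj_eq[OF assms])
  moreover have "?E = (\<chi> i. if i = m then row m (mat 1) + c *s row n (mat 1) else row i (mat 1))"
    using 5 by (auto simp: vec_eq_iff mat_def row_def)
  ultimately show ?case
    using 5 assms by (simp add: det_row_operation inj_eq[OF assms])
qed

lemma det_block_left: "det (four_block A 0 0 (mat 1) :: real^('a::finite + 'b::finite)^('a + 'b)) = det A"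
proof -
  have "four_block A 0 0 (mat 1) = (embed_matrix Inl A :: real^('a + 'b)^('a + 'b))"
    by (auto simp: vec_eq_iff forall_sum embed_matrix_def mat_def)
  then show ?thesis
    by (simp add: det_embed_matrix)
qed

lemma det_block_right: "det (four_block (mat 1) 0 0 D :: real^('a::finite + 'b::finite)^('a + 'b)) = det D"
proof -
  have "four_block (mat 1) 0 0 D = (embed_matrix Inr D :: real^('a + 'b)^('a + 'b))"
    by (auto simp: vec_eq_iff forall_sum embed_matrix_def mat_def)
  then show ?thesis
    by (simp add: det_embed_matrix)
qed

text \<open>
  A shear is conjugate to its own square, by a diagonal matrix, so its determinant is idempotent;
  it is nonzero because the shear is invertible.
\<close>

lemma det_lower_shear: "det (four_block (mat 1) 0 (C :: real^'a::finite^'b::finite) (mat 1)) = 1"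
proof -
  let ?L = "\<lambda>C :: real^'a^'b. four_block (mat 1) 0 C (mat 1)"
  let ?S = "\<lambda>r. four_block (r *\<^sub>R mat 1) 0 0 (mat 1) :: real^('a + 'b)^('a + 'b)"
  have square: "det (?L (2 *\<^sub>R C)) = det (?L C) * det (?L C)"
    by (simp add: det_mul[symmetric] four_block_mult scaleR_2)
  have same: "det (?L (2 *\<^sub>R C)) = det (?L C)"
  proof -
    have inv: "det (?S 2) * det (?S (1/2)) = 1"
      by (simp add: det_mul[symmetric] four_block_mult matrix_mult_simps four_block_mat_1)
    have "?L (2 *\<^sub>R C) = ?S (1/2) ** ?L C ** ?S 2"
      by (simp add: four_block_mult matrix_mult_simps four_block_mat_1)
    then have "det (?L (2 *\<^sub>R C)) = det (?S (1/2)) * det (?L C) * det (?S 2)"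
      by (simp only: det_mul)
    also have "\<dots> = det (?S 2) * det (?S (1/2)) * det (?L C)"
      by (simp only: ac_simps)
    finally show ?thesis
      by (simp only: inv mult_1)
  qed
  have inv: "det (?L C) * det (?L (- C)) = 1"
    by (simp add: det_mul[symmetric] four_block_mult four_block_mat_1)
  then have "det (?L C) = det (?L C) * det (?L C) * det (?L (- C))"
    by (simp only: mult.assoc mult_1_right)
  also have "\<dots> = 1"
    using inv by (simp only: square[symmetric] same)
  finally show ?thesis .
qed

text \<open>
  The matrix factors into a shear and two block diagonal matrices with one trivial block.
\<close>

lemma det_lower_block: "det (four_block A 0 C D) = det A * det D"
proof -
  have "four_block A 0 C D =
      four_block A 0 0 (mat 1) ** four_block (mat 1) 0 C (mat 1) ** four_block (mat 1) 0 0 D"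
    by (simp add: four_block_mult)
  then show ?thesis
    by (simp add: det_mul det_block_left det_block_right det_lower_shear)
qed

lemma det_upper_block: "det (four_block A B 0 D) = det A * det D"
proof -
  have "four_block A B 0 D = transpose (four_block (transpose A) 0 (transpose B) (transpose D))"
    by (simp add: vec_eq_iff forall_sum transpose_def)
  then show ?thesis
    by (simp add: det_lower_block)
qed

text \<open>
  Both sides are the determinant of the same block matrix, which can be triangularised by
  eliminating either of its off-diagonal blocks.
\<close>

lemma det_sylvester:
  fixes S :: "real^'a^'b" and V :: "real^'b^'a"
  shows "det (mat 1 + S ** V) = det (mat 1 + V ** S)"
proof -
  let ?M = "four_block (mat 1) (- V) S (mat 1)"
  have "?M = four_block (mat 1) 0 S (mat 1) ** four_block (mat 1) (- V) 0 (mat 1 + S ** V)"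
    by (simp add: four_block_mult matrix_mult_simps)
  then have "det ?M = det (mat 1 + S ** V)"
    by (simp add: det_mul det_lower_block det_upper_block)
  moreover have "?M = four_block (mat 1) (- V) 0 (mat 1) ** four_block (mat 1 + V ** S) 0 S (mat 1)"
    by (simp add: four_block_mult matrix_mult_simps)
  then have "det ?M = det (mat 1 + V ** S)"
    by (simp add: det_mul det_lower_block det_upper_block)
  ultimately show ?thesis
    by simp
qed

section \<open>Stage matrices of Runge--Kutta methods\<close>

definition blocks :: "('s::finite \<Rightarrow> 's \<Rightarrow> real^'n^'n) \<Rightarrow> real^('s \<times> 'n)^('s \<times> 'n)" where
  "blocks B = (\<chi> p q. B (fst p) (fst q) $ snd p $ snd q)"

lemma blocks_mult:
  fixes B C :: "'s::finite \<Rightarrow> 's \<Rightarrow> real^'n^'n"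
  shows "blocks B ** blocks C = blocks (\<lambda>i j. \<Sum>k\<in>UNIV. B i k ** C k j)"
proof -
  have "(\<Sum>q\<in>UNIV. B i (fst q) $ p $ snd q * C (fst q) j $ snd q $ r)
      = (\<Sum>k\<in>UNIV. \<Sum>q\<in>UNIV. B i k $ p $ q * C k j $ q $ r)" for i j p r
    by (simp add: sum.cartesian_product split_def)
  then show ?thesis
    by (simp add: blocks_def vec_eq_iff matrix_matrix_mult_def)
qed

text \<open>
  The block diagonal matrices with blocks \<open>Q i\<close> and \<open>Q' i\<close> are inverse to each other.
\<close>

lemma det_blocks_conj:
  fixes B :: "'s::finite \<Rightarrow> 's \<Rightarrow> real^'n^'n"
    and Q Q' :: "'s \<Rightarrow> real^'n^'n"
  assumes inv: "\<And>i. Q i ** Q' i = mat 1"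
  shows "det (blocks (\<lambda>i j. Q i ** B i j ** Q' j)) = det (blocks B)"
proof -
  let ?D = "\<lambda>Q. blocks (\<lambda>i j. if i = j then Q i else 0)"
  have DX: "?D X ** blocks C = blocks (\<lambda>i j. X i ** C i j)" for X C
  proof -
    have "(\<Sum>k\<in>UNIV. (if i = k then X i else 0) ** C k j) = (\<Sum>k\<in>UNIV. if i = k then X i ** C i j else 0)" for i j
      by (rule sum.cong) (auto simp: matrix_mult_simps)
    then show ?thesis
      by (simp add: blocks_mult)
  qed
  have XD: "blocks C ** ?D X = blocks (\<lambda>i j. C i j ** X j)" for X C
  proof -
    have "(\<Sum>k\<in>UNIV. C i k ** (if k = j then X k else 0)) = (\<Sum>k\<in>UNIV. if k = j then C i j ** X j else 0)" for i j
      by (rule sum.cong) (auto simp: matrix_mult_simps)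
    then show ?thesis
      by (simp add: blocks_mult)
  qed
  have "?D Q ** ?D Q' = blocks (\<lambda>i j. if i = j then mat 1 else 0)"
    unfolding DX by (rule arg_cong[of _ _ blocks]) (auto simp: fun_eq_iff inv matrix_mult_simps)
  also have "\<dots> = mat 1"
    by (auto simp: blocks_def vec_eq_iff mat_def prod_eq_iff)
  finally have "det (?D Q) * det (?D Q') = 1"
    by (simp only: det_mul[symmetric] det_I)
  then have "det (?D Q) * det (blocks B) * det (?D Q') = det (blocks B)"
    by (simp only: mult.assoc mult.left_commute mult_1_right)
  then show ?thesis
    by (simp only: det_mul[symmetric] DX XD)
qed

text \<open>
  The matrix of the linear system for the derivatives of the stages of a Runge--Kutta method: the
  coefficients \<open>a\<close> include the stepsize, and \<open>G j\<close> is the Jacobian of the vector field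
  at the \<open>j\<close>-th stage.
\<close>

definition stage_matrix :: "('s::finite \<Rightarrow> 's \<Rightarrow> real) \<Rightarrow> ('s \<Rightarrow> real^'n^'n) \<Rightarrow> real^('s \<times> 'n)^('s \<times> 'n)" where
  "stage_matrix a G = blocks (\<lambda>i j. (if i = j then mat 1 else 0) - a i j *\<^sub>R G j)"

text \<open>
  If \<open>S\<close> are the derivatives of the stages, then the right hand side contains the derivative
  \<open>U = I + V S\<close> of the Runge--Kutta step, where \<open>V\<close> is the block row with entries
  \<open>b j G j\<close>.  With \<open>N\<close> the stage matrix and \<open>1\<close> the block column of identities,
  \<open>N S = 1\<close>, so \<open>N (I + S V) = N + 1 V\<close> is the stage matrix with the coefficients
  \<open>a i j - b j\<close>; and \<open>I + S V\<close> has the same determinant as \<open>U\<close>.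
\<close>

lemma det_stage_matrix_update:
  fixes a :: "'s::finite \<Rightarrow> 's \<Rightarrow> real" and b :: "'s \<Rightarrow> real" and G S :: "'s \<Rightarrow> real^'n^'n"
  assumes S: "\<And>i. S i = mat 1 + (\<Sum>j\<in>UNIV. a i j *\<^sub>R (G j ** S j))"
  shows "det (stage_matrix (\<lambda>i j. a i j - b j) G)
    = det (stage_matrix a G) * det (mat 1 + (\<Sum>j\<in>UNIV. b j *\<^sub>R (G j ** S j)))"
proof -
  let ?N = "stage_matrix a G"
  define Sm :: "real^'n^('s \<times> 'n)" where "Sm = (\<chi> p. S (fst p) $ snd p)"
  define V :: "real^('s \<times> 'n)^'n" where "V = (\<chi> r q. (b (fst q) *\<^sub>R G (fst q)) $ r $ snd q)"
  have SV: "mat 1 + Sm ** V = blocks (\<lambda>i j. (if i = j then mat 1 else 0) + b j *\<^sub>R (S i ** G j))"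
    by (auto simp: vec_eq_iff blocks_def Sm_def V_def matrix_matrix_mult_def mat_def prod_eq_iff
        sum_distrib_left mult_ac)
  have VS: "V ** Sm = (\<Sum>j\<in>UNIV. b j *\<^sub>R (G j ** S j))"
  proof -
    have "(\<Sum>q\<in>UNIV. b (fst q) * G (fst q) $ p $ snd q * S (fst q) $ snd q $ r)
      = (\<Sum>k\<in>UNIV. b k * (\<Sum>q\<in>UNIV. G k $ p $ q * S k $ q $ r))" for p r
      by (simp add: sum.cartesian_product split_def sum_distrib_left mult.assoc)
    then show ?thesis
      by (simp add: vec_eq_iff V_def Sm_def matrix_matrix_mult_def)
  qed
  have "?N ** (mat 1 + Sm ** V) = stage_matrix (\<lambda>i j. a i j - b j) G"
  proof -
    have "(\<Sum>k\<in>UNIV. ((if i = k then mat 1 else 0) - a i k *\<^sub>R G k)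
            ** ((if k = j then mat 1 else 0) + b j *\<^sub>R (S k ** G j)))
        = (if i = j then mat 1 else 0) - (a i j - b j) *\<^sub>R G j" for i j
    proof -
      have "(\<Sum>k\<in>UNIV. ((if i = k then mat 1 else 0) - a i k *\<^sub>R G k)
            ** ((if k = j then mat 1 else 0) + b j *\<^sub>R (S k ** G j)))
          = (\<Sum>k\<in>UNIV. if i = k then (if k = j then mat 1 else 0) + b j *\<^sub>R (S k ** G j) else 0)
            - (\<Sum>k\<in>UNIV. if k = j then a i k *\<^sub>R G k else 0)
            - (\<Sum>k\<in>UNIV. b j *\<^sub>R ((a i k *\<^sub>R (G k ** S k)) ** G j))"
        unfolding sum_subtractf[symmetric]
        by (intro sum.cong refl) (auto simp: matrix_mult_simps matrix_mul_assoc algebra_simps)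
      also have "\<dots> = (if i = j then mat 1 else 0) + b j *\<^sub>R (S i ** G j) - a i j *\<^sub>R G j
            - b j *\<^sub>R ((\<Sum>k\<in>UNIV. a i k *\<^sub>R (G k ** S k)) ** G j)"
        by (simp add: matrix_mult_simps scaleR_sum_right)
      also have "(\<Sum>k\<in>UNIV. a i k *\<^sub>R (G k ** S k)) = S i - mat 1"
        using S[of i] by simp
      finally show ?thesis
        by (simp add: matrix_mult_simps algebra_simps)
    qed
    then show ?thesis
      by (simp add: SV stage_matrix_def blocks_mult)
  qed
  then have "det (stage_matrix (\<lambda>i j. a i j - b j) G) = det ?N * det (mat 1 + Sm ** V)"
    by (simp only: det_mul[symmetric])
  then show ?thesis
    by (simp only: det_sylvester VS)
qed

text \<open>
  Symplecticity reads \<open>b i (a i j - b j) = - a j i b j\<close>.  So conjugation of block \<open>i\<close>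
  by \<open>b i\<close> replaces \<open>a i j - b j\<close> by \<open>- a j i\<close>, and conjugation by \<open>P\<close>
  removes the sign.  Both are done at once.
\<close>

lemma det_stage_matrix_adjoint:
  fixes a :: "'s::finite \<Rightarrow> 's \<Rightarrow> real" and G :: "'s \<Rightarrow> real^'n^'n" and P :: "real^'n^'n"
  assumes symp: "\<And>i j. b i * a i j + b j * a j i - b i * b j = 0"
    and nz: "\<And>j. b j \<noteq> 0"
    and P: "invertible P" "\<And>j. P ** G j = - G j ** P"
  shows "det (stage_matrix (\<lambda>i j. h * a i j - h * b j) G) = det (stage_matrix (\<lambda>i j. h * a j i) G)"
proof -
  note inv = mult_matrix_inv[OF P(1)]
  let ?B = "\<lambda>i j. (if i = j then mat 1 else 0) - (h * a i j - h * b j) *\<^sub>R G j"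
  have G: "P ** G j ** matrix_inv P = - G j" for j
    using conj_eq_minus_iff[OF P(1)] P(2) by blast
  have "(b i *\<^sub>R P) ** ?B i j ** ((1 / b j) *\<^sub>R matrix_inv P)
      = (if i = j then mat 1 else 0) - (h * a j i) *\<^sub>R G j" for i j
  proof -
    have "b i * (h * a i j - h * b j) / b j = - (h * a j i)"
    proof -
      have "b i * (h * a i j - h * b j) = - (h * a j i) * b j"
        using arg_cong[OF symp[of i j], of "(*) h"] by (simp add: algebra_simps)
      then show ?thesis
        using nz[of j] by simp
    qed
    moreover have "(b i *\<^sub>R P) ** (X - r *\<^sub>R G j) ** ((1 / b j) *\<^sub>R matrix_inv P)
        = (b i / b j) *\<^sub>R (P ** X ** matrix_inv P) + (b i * r / b j) *\<^sub>R G j" for X r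
      by (simp add: matrix_mult_simps G scaleR_add_right mult.commute)
    ultimately show ?thesis
      using nz[of j] by (simp add: inv matrix_mult_simps)
  qed
  moreover have "det (blocks (\<lambda>i j. (b i *\<^sub>R P) ** ?B i j ** ((1 / b j) *\<^sub>R matrix_inv P))) = det (blocks ?B)"
    using nz by (intro det_blocks_conj) (simp add: matrix_mult_simps inv)
  ultimately show ?thesis
    by (simp add: stage_matrix_def)
qed

lemma det_stage_matrix_transpose_1:
  fixes a :: "1 \<Rightarrow> 1 \<Rightarrow> real"
  shows "det (stage_matrix (\<lambda>i j. a j i) G) = det (stage_matrix a G)"
proof -
  have "(\<lambda>i j. a j i) = a"
  proof (intro ext)
    fix i j :: 1
    have "i = j"
      by (rule num1_eqI)
    then show "a j i = a i j" by simp
  qed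
  then show ?thesis by simp
qed

lemma tendsto_det:
  fixes F :: "'b \<Rightarrow> real^'n^'n"
  assumes "(F \<longlongrightarrow> A) X"
  shows "((\<lambda>x. det (F x)) \<longlongrightarrow> det A) X"
  unfolding det_def
  by (intro tendsto_sum tendsto_mult tendsto_prod tendsto_const tendsto_vec_nth assms)

lemma tendsto_stage_matrix:
  assumes "\<And>i j. ((\<lambda>x. a x i j) \<longlongrightarrow> a0 i j) X"
  shows "((\<lambda>x. stage_matrix (a x) G) \<longlongrightarrow> stage_matrix a0 G) X"
  unfolding stage_matrix_def blocks_def
  by (intro vec_tendstoI, unfold vec_lambda_beta)
    (intro tendsto_vec_nth tendsto_diff tendsto_scaleR tendsto_const assms)

text \<open>
  If both off-diagonal coefficients are nonzero, scaling the first block by their quotient exchanges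
  them.  The general case follows by adding a small \<open>e\<close> to all coefficients and letting it
  tend to 0, by continuity of the determinant.
\<close>

lemma det_stage_matrix_transpose_2:
  fixes a :: "2 \<Rightarrow> 2 \<Rightarrow> real" and G :: "2 \<Rightarrow> real^'n^'n"
  shows "det (stage_matrix (\<lambda>i j. a j i) G) = det (stage_matrix a G)"
proof -
  have nonzero: "det (stage_matrix (\<lambda>i j. a j i) G) = det (stage_matrix a G)"
    if nz: "a 1 2 \<noteq> 0" "a 2 1 \<noteq> 0" for a :: "2 \<Rightarrow> 2 \<Rightarrow> real"
  proof -
    define t where "t i = (if i = 1 then a 2 1 / a 1 2 else 1)" for i :: 2
    have t: "t i \<noteq> 0" for i
      using nz by (simp add: t_def)
    have "t i * a i j / t j = a j i" for i j
      using nz exhaust_2[of i] exhaust_2[of j] by (auto simp: t_def)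
    then have "(t i *\<^sub>R mat 1) ** ((if i = j then mat 1 else 0) - a i j *\<^sub>R G j) ** ((1 / t j) *\<^sub>R mat 1)
        = (if i = j then mat 1 else 0) - a j i *\<^sub>R G j" for i j
      using t[of j] by (simp add: matrix_mult_simps algebra_simps)
    moreover have "det (blocks (\<lambda>i j. (t i *\<^sub>R mat 1) **
          ((if i = j then mat 1 else 0) - a i j *\<^sub>R G j) ** ((1 / t j) *\<^sub>R mat 1)))
        = det (stage_matrix a G)"
      unfolding stage_matrix_def using t by (intro det_blocks_conj) (simp add: matrix_mult_simps)
    ultimately show ?thesis
      by (simp add: stage_matrix_def)
  qed
  let ?a = "\<lambda>e i j. a i j + e"
  have lim: "((\<lambda>e. ?a e i j) \<longlongrightarrow> a i j) (at 0)" for i j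
    using tendsto_add[OF tendsto_const[of "a i j"] tendsto_ident_at[of 0 UNIV]] by simp
  have ev: "\<forall>\<^sub>F e in at 0. ?a e 1 2 \<noteq> 0 \<and> ?a e 2 1 \<noteq> 0"
  proof -
    have "\<forall>\<^sub>F e in at 0. a i j + e \<noteq> 0" for i j
    proof (cases "a i j = 0")
      case True
      then show ?thesis
        by (simp add: eventually_at_filter)
    next
      case False
      then show ?thesis
        using tendsto_imp_eventually_ne[OF lim] by blast
    qed
    then show ?thesis
      by (intro eventually_conj)
  qed
  have "((\<lambda>e. det (stage_matrix (\<lambda>i j. ?a e j i) G)) \<longlongrightarrow> det (stage_matrix (\<lambda>i j. a j i) G)) (at 0)"
    by (intro tendsto_det tendsto_stage_matrix lim)
  moreover have "\<forall>\<^sub>F e in at 0. det (stage_matrix (\<lambda>i j. ?a e j i) G) = det (stage_matrix (?a e) G)"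
    by (rule eventually_mono[OF ev], rule nonzero) auto
  ultimately have "((\<lambda>e. det (stage_matrix (?a e) G)) \<longlongrightarrow> det (stage_matrix (\<lambda>i j. a j i) G)) (at 0)"
    by (rule Lim_transform_eventually)
  moreover have "((\<lambda>e. det (stage_matrix (?a e) G)) \<longlongrightarrow> det (stage_matrix a G)) (at 0)"
    by (intro tendsto_det tendsto_stage_matrix lim)
  ultimately show ?thesis
    by (rule LIM_unique)
qed

text \<open>
  The matrices \<open>Z\<close> are the derivatives of the stages.  Since the first propagator \<open>X\<close>
  acts on the initial value only, it splits off from them on the right, and the rest is the
  derivative of a plain symplectic Runge--Kutta step, whose determinant is 1.
\<close>

lemma det_symplectic_rk_update:
  fixes a :: "'s::finite \<Rightarrow> 's \<Rightarrow> real" and G Z :: "'s \<Rightarrow> real^'n^'n" and P X Y :: "real^'n^'n"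
  assumes symp: "\<And>i j. b i * a i j + b j * a j i - b i * b j = 0"
    and nz: "\<And>j. b j \<noteq> 0"
    and transp: "det (stage_matrix (\<lambda>i j. h * a j i) G) = det (stage_matrix (\<lambda>i j. h * a i j) G)"
    and inv: "invertible (stage_matrix (\<lambda>i j. h * a i j) G)"
    and P: "invertible P" "\<And>j. P ** G j = - G j ** P"
    and det_YX: "det (Y ** X) = 1"
    and Z: "\<And>i. Z i = X + (\<Sum>j\<in>UNIV. (h * a i j) *\<^sub>R (G j ** Z j))"
  shows "det (Y ** (X + (\<Sum>j\<in>UNIV. (h * b j) *\<^sub>R (G j ** Z j)))) = 1"
proof -
  let ?N = "stage_matrix (\<lambda>i j. h * a i j) G"
  let ?X' = "matrix_inv X"
  have "invertible X"
    using det_YX by (auto simp: invertible_det_nz det_mul)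
  note X' = mult_matrix_inv[OF this] matrix_inv_mult[OF this]
  define S where "S i = Z i ** ?X'" for i
  have Z_S: "Z i = S i ** X" for i
    by (simp add: S_def matrix_mul_assoc[symmetric] X')
  have "S i = (X + (\<Sum>j\<in>UNIV. (h * a i j) *\<^sub>R (G j ** Z j))) ** ?X'" for i
    unfolding S_def by (subst Z) (rule refl)
  also have "(X + (\<Sum>j\<in>UNIV. (h * a i j) *\<^sub>R (G j ** Z j))) ** ?X'
      = mat 1 + (\<Sum>j\<in>UNIV. (h * a i j) *\<^sub>R (G j ** S j))" for i
    by (simp add: matrix_mult_simps X' S_def matrix_mul_assoc)
  finally have S: "S i = mat 1 + (\<Sum>j\<in>UNIV. (h * a i j) *\<^sub>R (G j ** S j))" for i .
  let ?U = "mat 1 + (\<Sum>j\<in>UNIV. (h * b j) *\<^sub>R (G j ** S j))"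
  have "det (stage_matrix (\<lambda>i j. h * a i j - h * b j) G) = det (stage_matrix (\<lambda>i j. h * a j i) G)"
    by (rule det_stage_matrix_adjoint[OF symp nz P])
  moreover have "det (stage_matrix (\<lambda>i j. h * a i j - h * b j) G) = det ?N * det ?U"
    by (rule det_stage_matrix_update[OF S])
  ultimately have "det ?N * det ?U = det ?N"
    by (simp only: transp)
  then have "det ?U = 1"
    using inv by (simp add: invertible_det_nz)
  moreover have "X + (\<Sum>j\<in>UNIV. (h * b j) *\<^sub>R (G j ** Z j)) = ?U ** X"
    by (simp add: matrix_mult_simps Z_S matrix_mul_assoc)
  ultimately show ?thesis
    using det_YX by (simp add: det_mul)
qed

section \<open>Jacobians of Runge--Kutta steps\<close>

lemma jacobian_eqI:
  fixes f :: "real^'a \<Rightarrow> real^'b"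
  assumes "(f has_derivative (\<lambda>w. A *v w)) (at x)"
  shows "jacobian f (at x) = A"
  unfolding jacobian_def frechet_derivative_at[OF assms, symmetric] by simp

lemma has_derivative_matrix_vector_mult:
  fixes A :: "real^'a^'b"
  assumes "(f has_derivative f') F"
  shows "((\<lambda>x. A *v f x) has_derivative (\<lambda>w. A *v f' w)) F"
  by (rule bounded_linear.has_derivative[OF matrix_vector_mul_bounded_linear assms])

lemma has_derivative_jacobian:
  fixes f :: "real^'a \<Rightarrow> real^'b"
  shows "f differentiable (at x) \<Longrightarrow> (f has_derivative (\<lambda>w. jacobian f (at x) *v w)) (at x)"
  by (simp only: jacobian_works)

lemma sum_matrix_vector_mult: "(\<Sum>j\<in>J. A j) *v x = (\<Sum>j\<in>J. A j *v x)"
  by (induction J rule: infinite_finite_induct) (simp_all add: matrix_vector_mult_add_rdistrib)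

text \<open>
  The Runge--Kutta step has a vector field \<open>\<gamma> j\<close> of its own at each stage.  This accommodates
  a vector field that depends on the stages of another system as well.
\<close>

lemma det_jacobian_symplectic_rk:
  fixes a :: "'s::finite \<Rightarrow> 's \<Rightarrow> real" and \<gamma> :: "'s \<Rightarrow> real^'n \<Rightarrow> real^'n"
    and q :: "real^'n \<Rightarrow> 's \<Rightarrow> real^'n" and P X Y :: "real^'n^'n" and z :: "real^'n"
  defines "G \<equiv> \<lambda>j. jacobian (\<gamma> j) (at (q z j))"
  assumes symp: "\<And>i j. b i * a i j + b j * a j i - b i * b j = 0"
    and nz: "\<And>j. b j \<noteq> 0"
    and transp: "det (stage_matrix (\<lambda>i j. h * a j i) G) = det (stage_matrix (\<lambda>i j. h * a i j) G)"
    and inv: "invertible (stage_matrix (\<lambda>i j. h * a i j) G)"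
    and P: "invertible P" "\<And>j. P ** G j = - G j ** P"
    and det_YX: "det (Y ** X) = 1"
    and diff_\<gamma>: "\<And>j. \<gamma> j differentiable (at (q z j))"
    and diff_q: "\<And>i. (\<lambda>x. q x i) differentiable (at z)"
    and q: "\<And>x i. q x i = X *v x + h *\<^sub>R (\<Sum>j\<in>UNIV. a i j *\<^sub>R \<gamma> j (q x j))"
    and \<phi>: "\<And>x. \<phi> x = Y *v (X *v x + h *\<^sub>R (\<Sum>j\<in>UNIV. b j *\<^sub>R \<gamma> j (q x j)))"
  shows "det (jacobian \<phi> (at z)) = 1"
proof -
  define Z where "Z i = jacobian (\<lambda>x. q x i) (at z)" for i
  have \<gamma>q: "((\<lambda>x. \<gamma> j (q x j)) has_derivative (\<lambda>w. G j *v (Z j *v w))) (at z)" for j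
    using has_derivative_compose[OF has_derivative_jacobian[OF diff_q] has_derivative_jacobian[OF diff_\<gamma>]]
    by (simp add: G_def Z_def)
  have deriv: "((\<lambda>x. X *v x + h *\<^sub>R (\<Sum>j\<in>UNIV. r j *\<^sub>R \<gamma> j (q x j))) has_derivative
      (\<lambda>w. (X + (\<Sum>j\<in>UNIV. (h * r j) *\<^sub>R (G j ** Z j))) *v w)) (at z)" for r
  proof -
    have "((\<lambda>x. X *v x + h *\<^sub>R (\<Sum>j\<in>UNIV. r j *\<^sub>R \<gamma> j (q x j))) has_derivative
      (\<lambda>w. X *v w + h *\<^sub>R (\<Sum>j\<in>UNIV. r j *\<^sub>R (G j *v (Z j *v w))))) (at z)"
      by (intro has_derivative_add has_derivative_matrix_vector_mult has_derivative_ident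
          has_derivative_scaleR_right has_derivative_sum \<gamma>q)
    moreover have "X *v w + h *\<^sub>R (\<Sum>j\<in>UNIV. r j *\<^sub>R (G j *v (Z j *v w)))
        = (X + (\<Sum>j\<in>UNIV. (h * r j) *\<^sub>R (G j ** Z j))) *v w" for w
      by (simp add: matrix_vector_mult_add_rdistrib sum_matrix_vector_mult scaleR_sum_right
          scaleR_matrix_vector_assoc[symmetric] matrix_vector_mul_assoc)
    ultimately show ?thesis
      by (simp only:)
  qed
  have Z_eq: "Z i = X + (\<Sum>j\<in>UNIV. (h * a i j) *\<^sub>R (G j ** Z j))" for i
  proof -
    have "(\<lambda>x. q x i) = (\<lambda>x. X *v x + h *\<^sub>R (\<Sum>j\<in>UNIV. a i j *\<^sub>R \<gamma> j (q x j)))"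
      by (rule ext) (rule q)
    then have "((\<lambda>x. q x i) has_derivative
        (\<lambda>w. (X + (\<Sum>j\<in>UNIV. (h * a i j) *\<^sub>R (G j ** Z j))) *v w)) (at z)"
      by (rule ssubst) (rule deriv)
    then show ?thesis
      unfolding Z_def[of i] by (rule jacobian_eqI)
  qed
  have "jacobian \<phi> (at z) = Y ** (X + (\<Sum>j\<in>UNIV. (h * b j) *\<^sub>R (G j ** Z j)))"
  proof (rule jacobian_eqI)
    have "\<phi> = (\<lambda>x. Y *v (X *v x + h *\<^sub>R (\<Sum>j\<in>UNIV. b j *\<^sub>R \<gamma> j (q x j))))"
      by (rule ext) (rule \<phi>)
    then show "(\<phi> has_derivative (\<lambda>w. (Y ** (X + (\<Sum>j\<in>UNIV. (h * b j) *\<^sub>R (G j ** Z j)))) *v w)) (at z)"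
      unfolding matrix_vector_mul_assoc[symmetric]
      by (rule ssubst) (rule has_derivative_matrix_vector_mult[OF deriv[of b]])
  qed
  then show ?thesis
    using det_symplectic_rk_update[OF symp nz transp inv P det_YX Z_eq] by (rule ssubst)
qed

section \<open>Block triangular maps\<close>

lemma fst_block_nth [simp]: "fst_block y $ i = y $ Inl i"
  and snd_block_nth [simp]: "snd_block y $ j = y $ Inr j"
  and join_Inl [simp]: "join y1 y2 $ Inl i = y1 $ i"
  and join_Inr [simp]: "join y1 y2 $ Inr j = y2 $ j"
  by (simp_all add: fst_block_def snd_block_def join_def)

lemma fst_block_join [simp]: "fst_block (join y1 y2) = y1"
  and snd_block_join [simp]: "snd_block (join y1 y2) = y2"
  and join_fst_block_snd_block [simp]: "join (fst_block y) (snd_block y) = y"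
  by (simp_all add: vec_eq_iff forall_sum)

lemma linear_fst_block: "linear fst_block" and linear_snd_block: "linear snd_block"
  by (auto intro!: linearI simp: vec_eq_iff)

lemma four_block_mult_vec:
  "four_block A B C D *v y =
     join (A *v fst_block y + B *v snd_block y) (C *v fst_block y + D *v snd_block y)"
  by (simp add: vec_eq_iff forall_sum matrix_vector_mult_def sum_UNIV_Plus)

lemma four_block_exhaust:
  obtains A B C D where "M = four_block A B C D"
proof
  show "M = four_block (\<chi> i j. M $ Inl i $ Inl j) (\<chi> i j. M $ Inl i $ Inr j)
      (\<chi> i j. M $ Inr i $ Inl j) (\<chi> i j. M $ Inr i $ Inr j)"
    by (simp add: vec_eq_iff forall_sum)
qed

lemma has_derivative_fst_block:
  "(f has_derivative f') F \<Longrightarrow> ((\<lambda>x. fst_block (f x)) has_derivative (\<lambda>w. fst_block (f' w))) F"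
  by (rule bounded_linear.has_derivative[OF linear_fst_block[unfolded linear_conv_bounded_linear]])

lemma has_derivative_snd_block:
  "(f has_derivative f') F \<Longrightarrow> ((\<lambda>x. snd_block (f x)) has_derivative (\<lambda>w. snd_block (f' w))) F"
  by (rule bounded_linear.has_derivative[OF linear_snd_block[unfolded linear_conv_bounded_linear]])

lemma has_derivative_join_right:
  fixes y1 :: "real^'a"
  shows "((\<lambda>z :: real^'b. join y1 z) has_derivative (\<lambda>w. join 0 w)) F"
proof -
  have "bounded_linear (\<lambda>w :: real^'b. join (0 :: real^'a) w)"
    by (auto intro!: linearI simp: linear_conv_bounded_linear[symmetric] vec_eq_iff forall_sum)
  then have "((\<lambda>z. join y1 (0 :: real^'b) + join (0 :: real^'a) z) has_derivative (\<lambda>w. 0 + join 0 w)) F"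
    by (intro has_derivative_add has_derivative_const bounded_linear_imp_has_derivative)
  moreover have "join y1 0 + join 0 z = join y1 z" for z :: "real^'b"
    by (simp add: vec_eq_iff forall_sum)
  ultimately show ?thesis
    by (simp only: add_0)
qed

lemma has_derivative_join_left:
  fixes y2 :: "real^'b"
  shows "((\<lambda>z :: real^'a. join z y2) has_derivative (\<lambda>w. join w 0)) F"
proof -
  have "bounded_linear (\<lambda>w :: real^'a. join w (0 :: real^'b))"
    by (auto intro!: linearI simp: linear_conv_bounded_linear[symmetric] vec_eq_iff forall_sum)
  then have "((\<lambda>z. join (0 :: real^'a) y2 + join z (0 :: real^'b)) has_derivative (\<lambda>w. 0 + join w 0)) F"
    by (intro has_derivative_add has_derivative_const bounded_linear_imp_has_derivative)
  moreover have "join 0 y2 + join z 0 = join z y2" for z :: "real^'a"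
    by (simp add: vec_eq_iff forall_sum)
  ultimately show ?thesis
    by (simp only: add_0)
qed

text \<open>
  The blocks of the Jacobian are read off by restricting \<open>F\<close> to the two coordinate subspaces
  through \<open>y\<close>; the upper right one is the derivative of a constant.
\<close>

lemma jacobian_block_triangular:
  fixes F :: "real^('m::finite + 'n::finite) \<Rightarrow> real^('m + 'n)"
  assumes F: "F differentiable (at y)"
    and F1: "\<And>y. fst_block (F y) = F1 (fst_block y)"
  obtains C where "jacobian F (at y) = four_block (jacobian F1 (at (fst_block y))) 0 C
      (jacobian (\<lambda>z. snd_block (F (join (fst_block y) z))) (at (snd_block y)))"
proof -
  obtain A B C D where J: "jacobian F (at y) = four_block A B C D"
    by (rule four_block_exhaust)
  have der: "(F has_derivative (\<lambda>w. join (A *v fst_block w + B *v snd_block w) (C *v fst_block w + D *v snd_block w)))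
      (at (join (fst_block y) (snd_block y)))"
    using has_derivative_jacobian[OF F] by (simp add: J four_block_mult_vec)
  have zero: "fst_block (0 :: real^('m + 'n)) = 0" "snd_block (0 :: real^('m + 'n)) = 0"
    by (simp_all add: vec_eq_iff)
  have "((\<lambda>z. fst_block (F (join z (snd_block y)))) has_derivative (\<lambda>w. A *v w)) (at (fst_block y))"
    using has_derivative_fst_block[OF has_derivative_compose[OF has_derivative_join_left der]] by simp
  then have A: "jacobian F1 (at (fst_block y)) = A"
    unfolding F1 fst_block_join by (rule jacobian_eqI)
  have "((\<lambda>z. fst_block (F (join (fst_block y) z))) has_derivative (\<lambda>w. B *v w)) (at (snd_block y))"
    using has_derivative_fst_block[OF has_derivative_compose[OF has_derivative_join_right der]] by simp
  then have "jacobian (\<lambda>z :: real^'n. F1 (fst_block y)) (at (snd_block y)) = B"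
    unfolding F1 fst_block_join by (rule jacobian_eqI)
  moreover have "jacobian (\<lambda>z :: real^'n. F1 (fst_block y)) (at (snd_block y)) = 0"
    by (rule jacobian_eqI) simp
  ultimately have B: "B = 0"
    by simp
  have "((\<lambda>z. snd_block (F (join (fst_block y) z))) has_derivative (\<lambda>w. D *v w)) (at (snd_block y))"
    using has_derivative_snd_block[OF has_derivative_compose[OF has_derivative_join_right der]] by simp
  then have D: "jacobian (\<lambda>z. snd_block (F (join (fst_block y) z))) (at (snd_block y)) = D"
    by (rule jacobian_eqI)
  show ?thesis
    using that[of C] J by (simp only: A B D)
qed

text \<open>
  Vectors whose first blocks vanish form an invariant subspace of the big stage matrix, on which it
  acts as the stage matrix of the second diagonal blocks.
\<close>

lemma invertible_stage_matrix_snd_block: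
  fixes a :: "'s::finite \<Rightarrow> 's \<Rightarrow> real"
  assumes inv: "invertible (stage_matrix a G)"
    and G: "\<And>j. G j = four_block (A j) 0 (C j) (D j)"
  shows "invertible (stage_matrix a D)"
proof -
  \<comment> \<open>The inclusion of the second block into the whole space, stage by stage.\<close>
  define up :: "real^('s \<times> 'b) \<Rightarrow> real^('s \<times> ('a + 'b))"
    where "up w = (\<chi> p. join 0 (\<chi> q. w $ (fst p, q)) $ snd p)" for w
  have up_nth: "up w $ (i, Inl p) = 0" "up w $ (i, Inr q) = w $ (i, q)" for w i p q
    by (simp_all add: up_def)
  have sum_split: "(\<Sum>q\<in>UNIV. f q) = (\<Sum>j\<in>UNIV. \<Sum>q\<in>UNIV. f (j, q))"
    for f :: "'s \<times> 'c::finite \<Rightarrow> real"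
    by (simp add: sum.cartesian_product)
  have up_mult: "stage_matrix a G *v up w = up (stage_matrix a D *v w)" for w
  proof -
    have "(stage_matrix a G *v up w) $ (i, p) = up (stage_matrix a D *v w) $ (i, p)" for i p
    proof (cases p)
      case (Inl p')
      then show ?thesis
        by (simp add: up_nth matrix_vector_mult_def sum_split sum_UNIV_Plus stage_matrix_def blocks_def G mat_def)
          (auto simp: mat_def intro!: sum.neutral)
    next
      case (Inr p')
      then show ?thesis
        by (simp add: up_nth matrix_vector_mult_def sum_split sum_UNIV_Plus stage_matrix_def blocks_def G)
          (auto simp: mat_def intro!: sum.cong)
    qed
    then show ?thesis
      by (simp add: vec_eq_iff)
  qed
  have "w = 0" if "stage_matrix a D *v w = 0" for w
  proof -
    have "stage_matrix a G *v up w = 0"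
      using that by (simp add: up_mult) (simp add: vec_eq_iff up_nth forall_sum)
    then have "up w = 0"
      using inv by (simp only: invertible_left_inverse matrix_left_invertible_ker)
    then show "w = 0"
      by (simp add: vec_eq_iff forall_sum up_nth)
  qed
  then show ?thesis
    by (simp only: invertible_left_inverse matrix_left_invertible_ker) blast
qed

section \<open>SSEI methods for triangular vector fields\<close>

lemma matrix_of_block: "matrix fst_block *v y = fst_block y" "matrix snd_block *v y = snd_block y"
  by (simp_all add: matrix_works linear_matrix_vector_mul_eq linear_fst_block linear_snd_block)

lemma fst_block_block_diag: "fst_block (block_diag A B *v y) = A *v fst_block y"
  and snd_block_block_diag: "snd_block (block_diag A B *v y) = B *v snd_block y"
proof -
  have "block_diag A B = four_block A 0 0 B"
    by (simp add: vec_eq_iff forall_sum block_diag_def)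
  then show "fst_block (block_diag A B *v y) = A *v fst_block y"
    "snd_block (block_diag A B *v y) = B *v snd_block y"
    by (simp_all add: four_block_mult_vec)
qed

lemma fst_block_mat_exp:
  "fst_block (mat_exp (t *\<^sub>R block_diag A B) *v y) = mat_exp (t *\<^sub>R A) *v fst_block y"
proof -
  have "matrix fst_block ** (t *\<^sub>R block_diag A B) = (t *\<^sub>R A) ** matrix fst_block"
    by (simp add: matrix_eq matrix_vector_mul_assoc[symmetric] matrix_of_block
        scaleR_matrix_vector_assoc[symmetric] linear_scale[OF linear_fst_block] fst_block_block_diag)
  from arg_cong[OF mat_exp_intertwine[OF this], of "\<lambda>M. M *v y"] show ?thesis
    by (simp add: matrix_vector_mul_assoc[symmetric] matrix_of_block)
qed

lemma snd_block_mat_exp: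
  "snd_block (mat_exp (t *\<^sub>R block_diag A B) *v y) = mat_exp (t *\<^sub>R B) *v snd_block y"
proof -
  have "matrix snd_block ** (t *\<^sub>R block_diag A B) = (t *\<^sub>R B) ** matrix snd_block"
    by (simp add: matrix_eq matrix_vector_mul_assoc[symmetric] matrix_of_block
        scaleR_matrix_vector_assoc[symmetric] linear_scale[OF linear_snd_block] snd_block_block_diag)
  from arg_cong[OF mat_exp_intertwine[OF this], of "\<lambda>M. M *v y"] show ?thesis
    by (simp add: matrix_vector_mul_assoc[symmetric] matrix_of_block)
qed

lemma ssei_stages_eqs:
  assumes "ssei_well_posed T h K g"
  shows "ssei_stage_eqs T h K g y (ssei_stages T h K g y)"
  using assms unfolding ssei_well_posed_def ssei_stages_def by (blast intro: theI')

lemma ssei_stages_eqI: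
  assumes "ssei_well_posed T h K g" "ssei_stage_eqs T h K g y k"
  shows "ssei_stages T h K g y = k"
  using assms ssei_stages_eqs[OF assms(1)] unfolding ssei_well_posed_def by blast

lemma differentiable_ssei_stage:
  assumes "ssei_well_posed T h K g"
  shows "(\<lambda>y. ssei_stages T h K g y $ i) differentiable (at y)"
proof -
  have "ssei_stages T h K g differentiable (at y)"
    using assms by (simp add: ssei_well_posed_def)
  then obtain D where "(ssei_stages T h K g has_derivative D) (at y)"
    by (auto simp: differentiable_def)
  from bounded_linear.has_derivative[OF bounded_linear_vec_nth this] show ?thesis
    by (auto simp: differentiable_def)
qed

lemma differentiable_ssei_map:
  assumes wp: "ssei_well_posed T h K g" and g: "\<And>y. g differentiable (at y)"
  shows "ssei_map T h K g differentiable (at y)"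
proof -
  have stage: "((\<lambda>y. ssei_stages T h K g y $ i) has_derivative
      frechet_derivative (\<lambda>y. ssei_stages T h K g y $ i) (at y)) (at y)" (is "(_ has_derivative ?k i) _") for i
    using differentiable_ssei_stage[OF wp] by (simp only: frechet_derivative_works)
  have g': "(g has_derivative frechet_derivative g (at x)) (at x)" (is "(_ has_derivative ?g x) _") for x
    using g by (simp only: frechet_derivative_works)
  have "(ssei_map T h K g has_derivative (\<lambda>w. mat_exp (h *\<^sub>R K) *v w +
     h *\<^sub>R (\<Sum>i\<in>UNIV. rk_b T i *\<^sub>R
             (mat_exp (((1 - rk_c T i) * h) *\<^sub>R K) *v ?g (ssei_stages T h K g y $ i) (?k i w))))) (at y)"
    unfolding ssei_map_def[abs_def]
    by (intro has_derivative_add has_derivative_matrix_vector_mult has_derivative_ident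
        has_derivative_scaleR_right has_derivative_sum has_derivative_compose[OF stage g'])
  then show ?thesis
    by (rule differentiableI)
qed

lemma differentiable_partial_snd:
  assumes g: "\<And>y. g y = join (g1 (fst_block y)) (g2 (fst_block y) (snd_block y))"
    and diff: "\<And>y. g differentiable (at y)"
  shows "g2 y1 differentiable (at y2)"
proof -
  have "((\<lambda>z. snd_block (g (join y1 z))) has_derivative
      (\<lambda>w. snd_block (jacobian g (at (join y1 y2)) *v join 0 w))) (at y2)"
    by (intro has_derivative_snd_block has_derivative_compose[OF has_derivative_join_right]
        has_derivative_jacobian diff)
  then show ?thesis
    unfolding g fst_block_join snd_block_join by (rule differentiableI)
qed

text \<open>
  One method and one stepsize, applied to the triangular system and to its first equation.  The
  matrix \<open>K\<close> and the map \<open>g\<close> are parameters subject to equations, rather than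
  abbreviations, so that rewriting can keep them folded inside the stages.
\<close>

locale partitioned_ssei =
  fixes T :: "('s::finite) rk_tableau" and h :: real
    and K11 :: "real^'m::finite^'m" and K22 :: "real^'n::finite^'n"
    and g1 :: "real^'m \<Rightarrow> real^'m" and g2 :: "real^'m \<Rightarrow> real^'n \<Rightarrow> real^'n"
    and K :: "real^('m + 'n)^('m + 'n)" and g :: "real^('m + 'n) \<Rightarrow> real^('m + 'n)"
  assumes K: "K = block_diag K11 K22"
    and g: "\<And>y. g y = join (g1 (fst_block y)) (g2 (fst_block y) (snd_block y))"
    and well_posed_fst: "ssei_well_posed T h K11 g1"
    and well_posed: "ssei_well_posed T h K g"
    and differentiable_g: "\<And>y. g differentiable (at y)"
begin

lemmas fst_block_simps = linear_add[OF linear_fst_block] linear_scale[OF linear_fst_block]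
  linear_sum[OF linear_fst_block] fst_block_mat_exp[of _ K11 K22, folded K] g fst_block_join

lemmas snd_block_simps = linear_add[OF linear_snd_block] linear_scale[OF linear_snd_block]
  linear_sum[OF linear_snd_block] snd_block_mat_exp[of _ K11 K22, folded K] g snd_block_join

lemma ssei_stage_nth:
  "ssei_stages T h K g y $ i = mat_exp ((rk_c T i * h) *\<^sub>R K) *v y +
     h *\<^sub>R (\<Sum>j\<in>UNIV. rk_a T i j *\<^sub>R
        (mat_exp (((rk_c T i - rk_c T j) * h) *\<^sub>R K) *v g (ssei_stages T h K g y $ j)))"
  using ssei_stages_eqs[OF well_posed] unfolding ssei_stage_eqs_def by blast

text \<open>
  The first blocks solve the stage equations of the first system, whose solution is unique.
\<close>

lemma fst_block_ssei_stages:
  "fst_block (ssei_stages T h K g y $ i) = ssei_stages T h K11 g1 (fst_block y) $ i"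
proof -
  have "fst_block (ssei_stages T h K g y $ i) = mat_exp ((rk_c T i * h) *\<^sub>R K11) *v fst_block y +
      h *\<^sub>R (\<Sum>j\<in>UNIV. rk_a T i j *\<^sub>R (mat_exp (((rk_c T i - rk_c T j) * h) *\<^sub>R K11) *v
        g1 (fst_block (ssei_stages T h K g y $ j))))" for i
    by (rule trans[OF arg_cong[OF ssei_stage_nth, of fst_block]]) (simp only: fst_block_simps)
  then have "ssei_stage_eqs T h K11 g1 (fst_block y) (\<chi> i. fst_block (ssei_stages T h K g y $ i))"
    unfolding ssei_stage_eqs_def vec_lambda_beta by (rule allI)
  from ssei_stages_eqI[OF well_posed_fst this] show ?thesis
    by (simp only: vec_lambda_beta)
qed

lemma snd_block_ssei_stages:
  "snd_block (ssei_stages T h K g y $ i) = mat_exp ((rk_c T i * h) *\<^sub>R K22) *v snd_block y +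
     h *\<^sub>R (\<Sum>j\<in>UNIV. rk_a T i j *\<^sub>R (mat_exp (((rk_c T i - rk_c T j) * h) *\<^sub>R K22) *v
       g2 (ssei_stages T h K11 g1 (fst_block y) $ j) (snd_block (ssei_stages T h K g y $ j))))"
  by (rule trans[OF arg_cong[OF ssei_stage_nth, of snd_block]])
    (simp only: snd_block_simps fst_block_ssei_stages)

lemma fst_block_ssei_map: "fst_block (ssei_map T h K g y) = ssei_map T h K11 g1 (fst_block y)"
  unfolding ssei_map_def by (simp only: fst_block_simps fst_block_ssei_stages)

lemma snd_block_ssei_map:
  "snd_block (ssei_map T h K g y) = mat_exp (h *\<^sub>R K22) *v snd_block y +
     h *\<^sub>R (\<Sum>i\<in>UNIV. rk_b T i *\<^sub>R (mat_exp (((1 - rk_c T i) * h) *\<^sub>R K22) *v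
       g2 (ssei_stages T h K11 g1 (fst_block y) $ i) (snd_block (ssei_stages T h K g y $ i))))"
  unfolding ssei_map_def by (simp only: snd_block_simps fst_block_ssei_stages)

lemma differentiable_g2: "g2 y1 differentiable (at y2)"
  by (rule differentiable_partial_snd[OF g differentiable_g])

lemma jacobian_g:
  obtains C where "jacobian g (at y) = four_block (jacobian g1 (at (fst_block y))) 0 C
    (jacobian (g2 (fst_block y)) (at (snd_block y)))"
proof (rule jacobian_block_triangular[OF differentiable_g[of y], of g1])
  show "fst_block (g y) = g1 (fst_block y)" for y
    by (simp only: g fst_block_join)
qed (simp only: g fst_block_join snd_block_join)

lemma invertible_stage_matrix_snd:
  assumes c: "\<And>i. rk_c T i = c"
  shows "invertible (stage_matrix (\<lambda>i j. h * rk_a T i j)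
    (\<lambda>j. jacobian (g2 (ssei_stages T h K11 g1 (fst_block y) $ j))
       (at (snd_block (ssei_stages T h K g y $ j)))))"
proof -
  let ?k = "ssei_stages T h K g y"
  have "ssei_block_matrix T h K g ?k
      = stage_matrix (\<lambda>i j. h * rk_a T i j) (\<lambda>j. jacobian g (at (?k $ j)))"
    by (simp add: ssei_block_matrix_def stage_matrix_def blocks_def c mat_exp_0)
  moreover have "invertible (ssei_block_matrix T h K g ?k)"
    using well_posed unfolding ssei_well_posed_def by blast
  ultimately have "invertible (stage_matrix (\<lambda>i j. h * rk_a T i j) (\<lambda>j. jacobian g (at (?k $ j))))"
    by (simp only:)
  moreover have "\<exists>C. \<forall>j. jacobian g (at (?k $ j)) = four_block (jacobian g1 (at (fst_block (?k $ j)))) 0 (C j)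
      (jacobian (g2 (fst_block (?k $ j))) (at (snd_block (?k $ j))))"
    by (rule choice, rule allI, rule jacobian_g, rule exI)
  then obtain C where "\<And>j. jacobian g (at (?k $ j)) = four_block (jacobian g1 (at (fst_block (?k $ j)))) 0 (C j)
      (jacobian (g2 (fst_block (?k $ j))) (at (snd_block (?k $ j))))"
    by blast
  ultimately show ?thesis
    unfolding fst_block_ssei_stages[symmetric] by (rule invertible_stage_matrix_snd_block)
qed

text \<open>
  With equal nodes the propagators between stages are trivial.  For a fixed first argument
  \<open>y1\<close>, the second component is then a Runge--Kutta step between the propagators \<open>X\<close> and
  \<open>Y\<close>, with the vector field at stage \<open>j\<close> obtained from \<open>g2\<close> by inserting the stages
  of the first system, which do not depend on the second argument.
\<close>

lemma det_jacobian_snd_ssei_map: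
  assumes coeffs: "ssei_coeffs T" and c: "\<And>i. rk_c T i = c"
    and transp: "\<And>(a :: 's \<Rightarrow> 's \<Rightarrow> real) (G :: 's \<Rightarrow> real^'n^'n).
        det (stage_matrix (\<lambda>i j. a j i) G) = det (stage_matrix a G)"
    and P: "invertible P" "P ** K22 = - K22 ** P"
      "\<And>y1 y2. P ** jacobian (g2 y1) (at y2) = - jacobian (g2 y1) (at y2) ** P"
  shows "det (jacobian (\<lambda>z. snd_block (ssei_map T h K g (join y1 z))) (at y2)) = 1"
proof (rule det_jacobian_symplectic_rk[where h = h and a = "rk_a T" and b = "rk_b T" and P = P
      and X = "mat_exp ((c * h) *\<^sub>R K22)" and Y = "mat_exp (((1 - c) * h) *\<^sub>R K22)"
      and \<gamma> = "\<lambda>j. g2 (ssei_stages T h K11 g1 y1 $ j)"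
      and q = "\<lambda>z j. snd_block (ssei_stages T h K g (join y1 z) $ j)"])
  show "rk_b T i * rk_a T i j + rk_b T j * rk_a T j i - rk_b T i * rk_b T j = 0" "rk_b T j \<noteq> 0" for i j
    using coeffs by (simp_all add: ssei_coeffs_def)
  have exp: "mat_exp (h *\<^sub>R K22) = mat_exp (((1 - c) * h) *\<^sub>R K22) ** mat_exp ((c * h) *\<^sub>R K22)"
    unfolding mat_exp_add[symmetric] by (simp add: algebra_simps)
  then show "det (mat_exp (((1 - c) * h) *\<^sub>R K22) ** mat_exp ((c * h) *\<^sub>R K22)) = 1"
    using det_mat_exp_eq_1[OF P(1,2), of h] by (simp only:)
  show "invertible (stage_matrix (\<lambda>i j. h * rk_a T i j)
      (\<lambda>j. jacobian (g2 (ssei_stages T h K11 g1 y1 $ j)) (at (snd_block (ssei_stages T h K g (join y1 y2) $ j)))))"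
    using invertible_stage_matrix_snd[OF c, of "join y1 y2"] by (simp only: fst_block_join)
  show "(\<lambda>z. snd_block (ssei_stages T h K g (join y1 z) $ i)) differentiable (at y2)" for i
  proof -
    have "((\<lambda>y. ssei_stages T h K g y $ i) has_derivative
        (\<lambda>w. jacobian (\<lambda>y. ssei_stages T h K g y $ i) (at (join y1 y2)) *v w)) (at (join y1 y2))"
      by (rule has_derivative_jacobian[OF differentiable_ssei_stage[OF well_posed]])
    from has_derivative_snd_block[OF has_derivative_compose[OF has_derivative_join_right this]]
    show ?thesis
      by (rule differentiableI)
  qed
  show "snd_block (ssei_stages T h K g (join y1 z) $ i) = mat_exp ((c * h) *\<^sub>R K22) *v z +
      h *\<^sub>R (\<Sum>j\<in>UNIV. rk_a T i j *\<^sub>R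
        g2 (ssei_stages T h K11 g1 y1 $ j) (snd_block (ssei_stages T h K g (join y1 z) $ j)))" for z i
    by (subst snd_block_ssei_stages) (simp add: c mat_exp_0)
  show "snd_block (ssei_map T h K g (join y1 z)) = mat_exp (((1 - c) * h) *\<^sub>R K22) *v
      (mat_exp ((c * h) *\<^sub>R K22) *v z + h *\<^sub>R (\<Sum>j\<in>UNIV. rk_b T j *\<^sub>R
        g2 (ssei_stages T h K11 g1 y1 $ j) (snd_block (ssei_stages T h K g (join y1 z) $ j))))" for z
    unfolding snd_block_ssei_map fst_block_join snd_block_join exp c
    by (simp add: matrix_vector_right_distrib matrix_vector_mul_assoc
        linear_sum[OF matrix_vector_mul_linear] matrix_vector_mult_scaleR)
qed (use P transp differentiable_g2 in \<open>simp_all\<close>)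

lemma det_jacobian_ssei_map:
  assumes "ssei_coeffs T" "\<And>i. rk_c T i = c"
    and "\<And>(a :: 's \<Rightarrow> 's \<Rightarrow> real) (G :: 's \<Rightarrow> real^'n^'n).
        det (stage_matrix (\<lambda>i j. a j i) G) = det (stage_matrix a G)"
    and "invertible P" "P ** K22 = - K22 ** P"
      "\<And>y1 y2. P ** jacobian (g2 y1) (at y2) = - jacobian (g2 y1) (at y2) ** P"
  shows "det (jacobian (ssei_map T h K g) (at y)) = det (jacobian (ssei_map T h K11 g1) (at (fst_block y)))"
proof (rule jacobian_block_triangular[OF differentiable_ssei_map[OF well_posed differentiable_g], of "ssei_map T h K11 g1" y])
  show "fst_block (ssei_map T h K g y) = ssei_map T h K11 g1 (fst_block y)" for y
    by (rule fst_block_ssei_map)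
qed (simp only: det_lower_block det_jacobian_snd_ssei_map[OF assms] mult_1_right)

end

section \<open>Compositions\<close>

lemma has_derivative_comp_jacobian:
  fixes f :: "real^'d \<Rightarrow> real^'d"
  assumes "f differentiable (at y)" "F differentiable (at (f y))"
  shows "((F \<circ> f) has_derivative (\<lambda>w. (jacobian F (at (f y)) ** jacobian f (at y)) *v w)) (at y)"
  unfolding matrix_vector_mul_assoc[symmetric] comp_def
  by (rule has_derivative_compose[OF has_derivative_jacobian[OF assms(1)] has_derivative_jacobian[OF assms(2)]])

lemma
  fixes y :: "real^'d"
  shows jacobian_id: "jacobian id (at y) = mat 1"
    and differentiable_id_at: "(id :: real^'d \<Rightarrow> real^'d) differentiable (at y)"
proof -
  have "(id has_derivative (\<lambda>w. mat 1 *v w)) (at y)"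
    unfolding id_def matrix_vector_mul_lid by (rule has_derivative_ident)
  then show "jacobian id (at y) = mat 1" "(id :: real^'d \<Rightarrow> real^'d) differentiable (at y)"
    by (rule jacobian_eqI, rule differentiableI)
qed

lemma small_ssei_step:
  fixes K11 :: "real^'m^'m" and K22 P :: "real^'n^'n"
  assumes K: "K = block_diag K11 K22"
    and g: "\<And>y. g y = join (g1 (fst_block y)) (g2 (fst_block y) (snd_block y))"
    and diff_g1: "\<And>y. g1 differentiable (at y)" and diff_g: "\<And>y. g differentiable (at y)"
    and P: "invertible P" "P ** K22 = - K22 ** P"
      "\<And>y1 y2. P ** jacobian (g2 y1) (at y2) = - jacobian (g2 y1) (at y2) ** P"
    and coeffs: "small_ssei_coeffs M"
    and wp1: "small_ssei_well_posed K11 g1 (M, h)" and wp: "small_ssei_well_posed K g (M, h)"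
  shows "small_ssei_map K11 g1 (M, h) differentiable (at y1) \<and>
    small_ssei_map K g (M, h) differentiable (at y) \<and>
    fst_block (small_ssei_map K g (M, h) y) = small_ssei_map K11 g1 (M, h) (fst_block y) \<and>
    det (jacobian (small_ssei_map K g (M, h)) (at y)) =
      det (jacobian (small_ssei_map K11 g1 (M, h)) (at (fst_block y)))"
proof (cases M)
  case (OneStage T)
  then interpret partitioned_ssei T h K11 K22 g1 g2 K g
    using K g wp1 wp diff_g by unfold_locales simp_all
  have "rk_c T i = rk_c T 1" for i
    by (rule arg_cong[OF num1_eqI])
  then show ?thesis
    using OneStage coeffs det_jacobian_ssei_map[OF _ _ det_stage_matrix_transpose_1 P, of "rk_c T 1" y]
      differentiable_ssei_map[OF well_posed_fst diff_g1] differentiable_ssei_map[OF well_posed diff_g]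
      fst_block_ssei_map
    by simp
next
  case (TwoStage T)
  then interpret partitioned_ssei T h K11 K22 g1 g2 K g
    using K g wp1 wp diff_g by unfold_locales simp_all
  have "rk_c T i = rk_c T 1" for i
    using TwoStage coeffs exhaust_2[of i] by auto
  then show ?thesis
    using TwoStage coeffs det_jacobian_ssei_map[OF _ _ det_stage_matrix_transpose_2 P, of "rk_c T 1" y]
      differentiable_ssei_map[OF well_posed_fst diff_g1] differentiable_ssei_map[OF well_posed diff_g]
      fst_block_ssei_map
    by simp
qed

text \<open>
  The determinants are compared stepwise but never required to be 1, as only the whole
  composition for the first system is known to preserve volume.
\<close>

lemma composition_map_jacobian:
  fixes K :: "real^('m::finite + 'n::finite)^('m + 'n)" and K11 :: "real^'m^'m"
  assumes "\<And>s y. s \<in> set ss \<Longrightarrow> small_ssei_map K11 g1 s differentiable (at y)"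
    and "\<And>s y. s \<in> set ss \<Longrightarrow> small_ssei_map K g s differentiable (at y)"
    and "\<And>s y. s \<in> set ss \<Longrightarrow> fst_block (small_ssei_map K g s y) = small_ssei_map K11 g1 s (fst_block y)"
    and "\<And>s y. s \<in> set ss \<Longrightarrow> det (jacobian (small_ssei_map K g s) (at y)) =
      det (jacobian (small_ssei_map K11 g1 s) (at (fst_block y)))"
  shows "(\<forall>y. composition_map K11 g1 ss differentiable (at y)) \<and>
    (\<forall>y. composition_map K g ss differentiable (at y) \<and>
      det (jacobian (composition_map K g ss) (at y)) =
      det (jacobian (composition_map K11 g1 ss) (at (fst_block y))))"
  using assms
proof (induction ss)
  case Nil
  show ?case
    by (simp only: composition_map.simps jacobian_id differentiable_id_at det_I simp_thms)
next
  case (Cons s ss)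
  let ?f = "small_ssei_map K g s" and ?F = "composition_map K g ss"
  let ?f1 = "small_ssei_map K11 g1 s" and ?F1 = "composition_map K11 g1 ss"
  have IH: "?F1 differentiable (at y1)" "?F differentiable (at y)"
    "det (jacobian ?F (at y)) = det (jacobian ?F1 (at (fst_block y)))" for y1 y
    using Cons by (simp_all add: Cons.prems)
  have s: "?f1 differentiable (at y1)" "?f differentiable (at y)"
    "fst_block (?f y) = ?f1 (fst_block y)"
    "det (jacobian ?f (at y)) = det (jacobian ?f1 (at (fst_block y)))" for y1 y
    using Cons.prems[of s] by simp_all
  note c1 = has_derivative_comp_jacobian[OF s(1) IH(1)]
  note c = has_derivative_comp_jacobian[OF s(2) IH(2)]
  have "det (jacobian (?F \<circ> ?f) (at y)) = det (jacobian (?F1 \<circ> ?f1) (at (fst_block y)))" for y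
    by (simp only: jacobian_eqI[OF c1] jacobian_eqI[OF c] det_mul IH(3) s(3,4))
  then show ?case
    unfolding composition_map.simps using differentiableI[OF c1] differentiableI[OF c] by blast
qed

theorem theorem4p7:
  fixes K11 :: "real^'m^'m" and K22 :: "real^'n^'n"
    and g1 :: "real^'m \<Rightarrow> real^'m" and g2 :: "real^'m \<Rightarrow> real^'n \<Rightarrow> real^'n"
    and u :: "real^'m \<Rightarrow> real^'m" and v :: "real^'m \<Rightarrow> real^'n \<Rightarrow> real^'n"
    and K :: "real^('m + 'n)^('m + 'n)"
    and g f :: "real^('m + 'n) \<Rightarrow> real^('m + 'n)"
    and method_steps :: "(small_ssei \<times> real) list"
  assumes u: "u = (\<lambda>y1. K11 *v y1 + g1 y1)"
    and v: "v = (\<lambda>y1 y2. K22 *v y2 + g2 y1 y2)"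
    and K: "K = block_diag K11 K22"
    and g: "g = (\<lambda>y. join (g1 (fst_block y)) (g2 (fst_block y) (snd_block y)))"
    and f: "f = (\<lambda>y. join (u (fst_block y)) (v (fst_block y) (snd_block y)))"
    and problem_u: "ssei_problem K11 g1"
    and problem_f: "ssei_problem K g"
    and nonempty: "method_steps \<noteq> []"
    and coeffs: "\<forall>(M, h) \<in> set method_steps. small_ssei_coeffs M"
    and well_posed_u: "\<forall>s \<in> set method_steps. small_ssei_well_posed K11 g1 s"
    and well_posed_f: "\<forall>s \<in> set method_steps. small_ssei_well_posed K g s"
    and vp_u: "volume_preserving (composition_map K11 g1 method_steps)"
    and P: "\<exists>P. invertible P \<and> (\<forall>y1 y2.
              P ** jacobian (\<lambda>z. v y1 z) (at y2) ** matrix_inv P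
                = - jacobian (\<lambda>z. v y1 z) (at y2) \<and>
              P ** jacobian (\<lambda>z. g2 y1 z) (at y2) ** matrix_inv P
                = - jacobian (\<lambda>z. g2 y1 z) (at y2))"
    and f_in_F2: "class_F2 UNIV f"
  shows "volume_preserving (composition_map K g method_steps)"
proof -
  obtain P where invP: "invertible P"
    and Pv: "\<And>y1 y2. P ** jacobian (\<lambda>z. v y1 z) (at y2) ** matrix_inv P = - jacobian (\<lambda>z. v y1 z) (at y2)"
    and Pg: "\<And>y1 y2. P ** jacobian (\<lambda>z. g2 y1 z) (at y2) ** matrix_inv P = - jacobian (\<lambda>z. g2 y1 z) (at y2)"
    using P by blast
  have g_eq: "g y = join (g1 (fst_block y)) (g2 (fst_block y) (snd_block y))" for y
    by (simp only: g)
  have diff_g1: "g1 differentiable (at y)" and diff_g: "g differentiable (at y')" for y y'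
    using problem_u problem_f by (simp_all add: ssei_problem_def)
  have anti_g2: "P ** jacobian (g2 y1) (at y2) = - jacobian (g2 y1) (at y2) ** P" for y1 y2
    using Pg[of y1 y2] unfolding conj_eq_minus_iff[OF invP] .
  \<comment> \<open>The linear part is the difference of the Jacobians of v and g2, at any point.\<close>
  have anti_K22: "P ** K22 = - K22 ** P"
  proof -
    let ?G = "jacobian (g2 0) (at 0)"
    have "g2 0 differentiable (at 0)"
      by (rule differentiable_partial_snd[OF g_eq diff_g])
    from has_derivative_add[OF has_derivative_matrix_vector_mult[OF has_derivative_ident] has_derivative_jacobian[OF this]]
    have "((\<lambda>z. v 0 z) has_derivative (\<lambda>w. (K22 + ?G) *v w)) (at 0)"
      unfolding v matrix_vector_mult_add_rdistrib .
    then have "jacobian (\<lambda>z. v 0 z) (at 0) = K22 + ?G"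
      by (rule jacobian_eqI)
    then have "P ** (K22 + ?G) = - (K22 + ?G) ** P"
      using Pv[of 0 0] unfolding conj_eq_minus_iff[OF invP] by (simp only:)
    then show ?thesis
      using anti_g2[of 0 0] by (simp add: matrix_mult_simps)
  qed
  have "(\<forall>y. composition_map K11 g1 method_steps differentiable (at y)) \<and>
    (\<forall>y. composition_map K g method_steps differentiable (at y) \<and>
      det (jacobian (composition_map K g method_steps) (at y)) =
      det (jacobian (composition_map K11 g1 method_steps) (at (fst_block y))))"
  proof (rule composition_map_jacobian)
    fix s assume s: "s \<in> set method_steps"
    obtain M h where Mh: "s = (M, h)"
      by (cases s)
    have "small_ssei_coeffs M" "small_ssei_well_posed K11 g1 (M, h)" "small_ssei_well_posed K g (M, h)"
      using coeffs well_posed_u well_posed_f s by (auto simp: Mh)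
    note step = small_ssei_step[OF K g_eq diff_g1 diff_g invP anti_K22 anti_g2 this]
    show "small_ssei_map K11 g1 s differentiable (at y1)" for y1
      using step unfolding Mh by blast
    show "small_ssei_map K g s differentiable (at y)" for y
      using step unfolding Mh by blast
    show "fst_block (small_ssei_map K g s y) = small_ssei_map K11 g1 s (fst_block y)" for y
      using step unfolding Mh by blast
    show "det (jacobian (small_ssei_map K g s) (at y)) =
        det (jacobian (small_ssei_map K11 g1 s) (at (fst_block y)))" for y
      using step unfolding Mh by blast
  qed
  then show ?thesis
    using vp_u by (simp add: volume_preserving_def)
qed

end
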